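(* Let $V(u,r)$ be a smooth radially symmetric potential on $\mathbb{R}\times\mathbb{R}^2$ (depending on $u$ and $r=|x|$) with $V(u,r)=0$ whenever $|u|\ge U$ or $r>R$, for some constants $U,R>0$. Let $W(u,t)=V(u,e^t)$ and $T=\ln R$ (so $W$ is supported in the semi-strip $\{|u|\le U,\ t\le T\}$), and consider the Hamiltonian system $$\dot u = p,\qquad \dot p = -e^{2t}W'_u(u,t),$$ with Hamiltonian $H=\tfrac12p^2+e^{2t}W(u,t)$. Then, unless $W$ vanishes identically, there exists a solution $(u(t),p(t))$, $t\in\mathbb{R}$, of this system having conjugate points.
   Context: A solution $u(t)$, $t\in\mathbb{R}$, has conjugate points if there exist $t_1<t_2$ and a solution $\xi\not\equiv0$ of the Jacobi (linearised) equation $\ddot\xi+e^{2t}W''_{uu}(u(t),t)\,\xi=0$ with $\xi(t_1)=\xi(t_2)=0$. (The system arises from radial solutions $u(r)$ of $\Delta u=-V'_u$ via the substitution $r=e^t$.) *)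

theory Defs
  imports "HOL-Analysis.Analysis"
begin

fun dirderiv :: "('a::real_normed_vector \<Rightarrow> real) \<Rightarrow> 'a list \<Rightarrow> 'a \<Rightarrow> real" where
  "dirderiv f [] = f"
| "dirderiv f (v # vs) = (\<lambda>x. deriv (\<lambda>s. dirderiv f vs (x + s *\<^sub>R v)) 0)"

definition smooth :: "('a::real_normed_vector \<Rightarrow> real) \<Rightarrow> bool" where
  "smooth f \<longleftrightarrow> (\<forall>vs x. dirderiv f vs differentiable (at x))"

definition is_solution :: "(real \<Rightarrow> real \<Rightarrow> real) \<Rightarrow> (real \<Rightarrow> real) \<Rightarrow> (real \<Rightarrow> real) \<Rightarrow> bool" where
  "is_solution W u p \<longleftrightarrow>
     (\<forall>t. (u has_real_derivative p t) (at t) \<and>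
          (p has_real_derivative - (exp (2 * t) * deriv (\<lambda>v. W v t) (u t))) (at t))"

definition has_conjugate_points :: "(real \<Rightarrow> real \<Rightarrow> real) \<Rightarrow> (real \<Rightarrow> real) \<Rightarrow> bool" where
  "has_conjugate_points W u \<longleftrightarrow>
     (\<exists>t1 t2 \<xi> \<eta>. t1 < t2 \<and> (\<exists>t. \<xi> t \<noteq> 0) \<and>
        (\<forall>t. (\<xi> has_real_derivative \<eta> t) (at t) \<and>
             (\<eta> has_real_derivative
                 - (exp (2 * t) * deriv (\<lambda>v. deriv (\<lambda>w. W w t) v) (u t) * \<xi> t)) (at t)) \<and>
        \<xi> t1 = 0 \<and> \<xi> t2 = 0)"

end

theory Submission
  imports Defs
begin

text \<open>
  Let \<open>E(u,t) = e\<^sup>2\<^sup>t W(u,t)\<close>. For small \<open>d\<close> and every \<open>s\<close> there is exactly one trajectory that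
  crosses the strip from \<open>-U\<close> to \<open>U\<close> during \<open>[s, s + d]\<close>. It minimises the action, it is a straight
  line before and after the crossing, and we let \<open>f(s)\<close> be its action during the crossing.
  The second variation of \<open>f\<close> is the index form of a field along the trajectory that is constant
  outside the window. Such fields are limits of compactly supported ones, so in the absence of
  conjugate points \<open>f\<close> is convex on the whole line. As \<open>f\<close> is bounded it is constant, and it equals
  the free action because \<open>E\<close> vanishes for large \<open>t\<close>.

  Comparing the trajectory with the straight line of slope \<open>2U/d\<close>, the integral of \<open>E\<close> along every
  such line is nonpositive. As \<open>d\<close> tends to \<open>0\<close> these integrals, divided by \<open>d\<close>, tend to the mean of
  \<open>E\<close> over a time slice, and the comparison is sharp enough to show that the mean is \<open>0\<close>. By Fubini
  the line integrals for a fixed \<open>d\<close> then have total \<open>0\<close>, hence all of them vanish, the lines are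
  themselves trajectories, and \<open>E\<^sub>u = 0\<close>.
\<close>

section \<open>Calculus on the real line\<close>

lemma has_real_derivative_imp_continuous_on:
  fixes f :: "real \<Rightarrow> real"
  assumes "\<And>x. x \<in> S \<Longrightarrow> (f has_real_derivative f' x) (at x)"
  shows "continuous_on S f"
  using assms by (auto intro!: continuous_at_imp_continuous_on DERIV_isCont)

lemma antiderivative_UNIV:
  fixes f :: "real \<Rightarrow> real"
  assumes f: "continuous_on UNIV f"
  obtains F where "\<And>x. (F has_real_derivative f x) (at x)" and "F 0 = 0"
proof -
  define F where "F x = integral {0..x} f - integral {x..0} f" for x
  have "(F has_real_derivative f x) (at x)" for x
  proof -
    \<comment> \<open>Near \<open>x\<close> the function \<open>F\<close> is, up to a constant, a
      single integral from \<open>a\<close>, so both signs of \<open>x\<close> are treated alike;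
      the margins of 1 keep \<open>x\<close> in the interior.\<close>
    define a b where "a = min 0 x - 1" and "b = max 0 x + 1"
    have int: "f integrable_on {c..d}" for c d
      using f by (meson continuous_on_subset integrable_continuous_interval subset_UNIV)
    have F_eq: "F y = integral {a..y} f - integral {a..0} f" if "y \<in> {a..b}" for y
    proof (cases "0 \<le> y")
      case True
      have "integral {a..0} f + integral {0..y} f = integral {a..y} f"
        using True by (intro Henstock_Kurzweil_Integration.integral_combine int) (auto simp: a_def)
      moreover have "integral {y..0} f = 0"
        using True by (cases "y = 0") auto
      ultimately show ?thesis by (simp add: F_def)
    next
      case False
      have "integral {a..y} f + integral {y..0} f = integral {a..0} f"
        using False that by (intro Henstock_Kurzweil_Integration.integral_combine int) auto
      then show ?thesis using False by (simp add: F_def)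
    qed
    have x: "x \<in> {a<..<b}"
      by (auto simp: a_def b_def)
    have "((\<lambda>y. integral {a..y} f) has_real_derivative f x) (at x within {a..b})"
      using x by (intro integral_has_real_derivative continuous_on_subset[OF f]) auto
    then have "((\<lambda>y. integral {a..y} f - integral {a..0} f) has_real_derivative f x)
        (at x within {a..b})"
      by (auto intro!: derivative_eq_intros)
    then have "(F has_real_derivative f x) (at x within {a..b})"
      by (rule has_field_derivative_transform_within[where d = 1]) (use x F_eq in auto)
    then show ?thesis
      using x at_within_interior[of x "{a..b}"] by simp
  qed
  moreover have "F 0 = 0"
    by (simp add: F_def)
  ultimately show thesis
    by (rule that)
qed

lemma deriv_bound_from_zero:
  fixes f :: "real \<Rightarrow> real"
  assumes "\<And>y. y \<in> {0..d} \<Longrightarrow> (f has_real_derivative f' y) (at y)"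
    and "\<And>y. y \<in> {0..d} \<Longrightarrow> \<bar>f' y\<bar> \<le> B" and "c \<in> {0..d}" "f c = 0" "y \<in> {0..d}"
  shows "\<bar>f y\<bar> \<le> B * d"
proof -
  have "norm (f y - f c) \<le> B * norm (y - c)"
    by (rule field_differentiable_bound[where S = "{0..d}" and f' = f'])
      (use assms in \<open>auto intro: has_field_derivative_at_within\<close>)
  also have "\<dots> \<le> B * d"
    using assms(2)[of c] assms(3,5) by (intro mult_left_mono) auto
  finally show ?thesis using assms by simp
qed

text \<open>By Rolle \<open>f'\<close> has a zero in the window; integrating the bound from there,
  and then once more from 0, costs one factor \<open>d\<close> each time.\<close>

lemma second_deriv_bound_dirichlet:
  fixes f :: "real \<Rightarrow> real"
  assumes d: "0 < d"
    and f: "\<And>y. y \<in> {0..d} \<Longrightarrow> (f has_real_derivative f' y) (at y)"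
    and f': "\<And>y. y \<in> {0..d} \<Longrightarrow> (f' has_real_derivative f'' y) (at y)"
    and B: "\<And>y. y \<in> {0..d} \<Longrightarrow> \<bar>f'' y\<bar> \<le> B"
    and "f 0 = 0" "f d = 0" and y: "y \<in> {0..d}"
  shows "\<bar>f' y\<bar> \<le> B * d" "\<bar>f y\<bar> \<le> B * d\<^sup>2"
proof -
  obtain c where c: "0 < c" "c < d" "f d - f 0 = (d - 0) * f' c"
    using MVT2[of 0 d f f'] d f by auto
  then have "f' c = 0"
    using assms by simp
  with c have *: "\<bar>f' y\<bar> \<le> B * d" if "y \<in> {0..d}" for y
    using deriv_bound_from_zero[OF f' B, of d c y] that by simp
  then show "\<bar>f' y\<bar> \<le> B * d" using y .
  show "\<bar>f y\<bar> \<le> B * d\<^sup>2"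
    using deriv_bound_from_zero[of d f f' "B * d" 0 y] f * \<open>f 0 = 0\<close> d y
    by (simp add: power2_eq_square)
qed

lemma integral_deriv_real:
  fixes f :: "real \<Rightarrow> real"
  assumes "a \<le> b" "\<And>x. x \<in> {a..b} \<Longrightarrow> (f has_real_derivative f' x) (at x)"
  shows "(f' has_integral (f b - f a)) {a..b}"
  using assms
  by (intro fundamental_theorem_of_calculus)
    (auto simp: has_real_derivative_iff_has_vector_derivative[symmetric]
      intro: has_field_derivative_at_within)

text \<open>A subsolution \<open>w\<close> of the Riccati equation completes the square in the index form:
  the integrand minus \<open>(w z\<^sup>2)'\<close> is at least \<open>(z' - w z)\<^sup>2\<close>.\<close>

lemma riccati_index_form:
  fixes z z' w w' q :: "real \<Rightarrow> real"
  assumes "a \<le> b"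
    and z: "\<And>x. x \<in> {a..b} \<Longrightarrow> (z has_real_derivative z' x) (at x)"
    and w: "\<And>x. x \<in> {a..b} \<Longrightarrow> (w has_real_derivative w' x) (at x)"
    and ineq: "\<And>x. x \<in> {a..b} \<Longrightarrow> w' x + (w x)\<^sup>2 + q x \<le> 0"
    and int: "(\<lambda>x. (z' x)\<^sup>2 - q x * (z x)\<^sup>2) integrable_on {a..b}"
  shows "w b * (z b)\<^sup>2 - w a * (z a)\<^sup>2 \<le> integral {a..b} (\<lambda>x. (z' x)\<^sup>2 - q x * (z x)\<^sup>2)"
proof -
  have "((\<lambda>x. w' x * (z x)\<^sup>2 + 2 * w x * z x * z' x) has_integral
      (w b * (z b)\<^sup>2 - w a * (z a)\<^sup>2)) {a..b}"
    by (rule integral_deriv_real[OF \<open>a \<le> b\<close>])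
      (auto intro!: derivative_eq_intros z w simp: algebra_simps)
  moreover have "w' x * (z x)\<^sup>2 + 2 * w x * z x * z' x \<le> (z' x)\<^sup>2 - q x * (z x)\<^sup>2"
    if "x \<in> {a..b}" for x
  proof -
    have "(w' x + (w x)\<^sup>2 + q x) * (z x)\<^sup>2 \<le> 0"
      using ineq[OF that] by (simp add: mult_nonpos_nonneg)
    moreover have "0 \<le> (z' x - w x * z x)\<^sup>2" by simp
    ultimately show ?thesis
      by (simp add: power2_eq_square algebra_simps)
  qed
  ultimately show ?thesis
    using int by (intro has_integral_le[OF _ integrable_integral]) auto
qed

text \<open>A Wirtinger inequality with a nonoptimal constant. The linear function
  \<open>- 2 * K * (x - d / 2)\<close> is a Riccati subsolution for the constant potential
  \<open>K\<close>, and the boundary terms vanish with \<open>z\<close>.\<close>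

lemma dirichlet_index_form_nonneg:
  fixes z z' :: "real \<Rightarrow> real"
  assumes d: "0 < d" and K: "0 \<le> K" "K * d\<^sup>2 \<le> 1"
    and z: "\<And>x. x \<in> {0..d} \<Longrightarrow> (z has_real_derivative z' x) (at x)"
    and z': "continuous_on {0..d} z'"
    and "z 0 = 0" "z d = 0"
  shows "0 \<le> integral {0..d} (\<lambda>x. (z' x)\<^sup>2 - K * (z x)\<^sup>2)"
proof -
  have cz: "continuous_on {0..d} z"
    by (rule has_real_derivative_imp_continuous_on[OF z])
  have "- 2 * K + (- 2 * K * (x - d / 2))\<^sup>2 + K \<le> 0" if "x \<in> {0..d}" for x
  proof -
    have "\<bar>2 * (x - d / 2)\<bar> \<le> \<bar>d\<bar>"
      using that by (auto simp: abs_le_iff)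
    then have "(2 * (x - d / 2))\<^sup>2 \<le> d\<^sup>2"
      by (simp only: abs_le_square_iff)
    then have "K * (2 * (x - d / 2))\<^sup>2 \<le> K * d\<^sup>2"
      by (rule mult_left_mono[OF _ K(1)])
    also note K(2)
    finally have "K * (K * (2 * (x - d / 2))\<^sup>2) \<le> K * 1"
      by (rule mult_left_mono[OF _ K(1)])
    then show ?thesis by (simp add: power2_eq_square algebra_simps)
  qed
  moreover have "(\<lambda>x. (z' x)\<^sup>2 - K * (z x)\<^sup>2) integrable_on {0..d}"
    by (intro integrable_continuous_interval continuous_intros z' cz)
  ultimately have "(- 2 * K * (d - d / 2)) * (z d)\<^sup>2 - (- 2 * K * (0 - d / 2)) * (z 0)\<^sup>2
      \<le> integral {0..d} (\<lambda>x. (z' x)\<^sup>2 - K * (z x)\<^sup>2)"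
    using d by (intro riccati_index_form[where w' = "\<lambda>_. - 2 * K"] z)
      (auto intro!: derivative_eq_intros)
  then show ?thesis using assms by simp
qed

text \<open>A bounded convex function on the line is constant, so a bounded nonconstant one violates
  convexity. Since \<open>f\<close> is only continuous, the violation is recorded by a concave
  parabola touching the graph from above.\<close>

lemma bounded_nonconstant_touching_parabola:
  fixes f :: "real \<Rightarrow> real"
  assumes f: "continuous_on UNIV f" and B: "\<And>x. \<bar>f x\<bar> \<le> B" and ne: "f x1 \<noteq> f x2"
  obtains x0 b c r where "0 < c" "0 < r"
    "\<And>h. \<bar>h\<bar> \<le> r \<Longrightarrow> f (x0 + h) \<le> f x0 + b * h - c * h\<^sup>2"
proof -
  have main: "\<exists>x0 b c r. 0 < c \<and> 0 < r \<and> (\<forall>h. \<bar>h\<bar> \<le> r \<longrightarrow> g (x0 + h) \<le> g x0 + b * h - c * h\<^sup>2)"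
    if g: "continuous_on UNIV g" and B: "\<And>x. \<bar>g x\<bar> \<le> B" and lt: "a < a'" "g a < g a'"
    for g :: "real \<Rightarrow> real" and a a' B
  proof -
    \<comment> \<open>Half of the secant slope: after tilting by \<open>k\<close>, the value at
      \<open>a'\<close> is still above the value at \<open>a\<close>.\<close>
    define k where "k = (g a' - g a) / (2 * (a' - a))"
    have "k * (2 * (a' - a)) = g a' - g a"
      unfolding k_def using lt by (intro nonzero_eq_divide_eq[THEN iffD1, OF _ refl]) auto
    then have k: "0 < k" "g a' - g a = 2 * (k * (a' - a))"
      using lt by (simp add: k_def, linarith)
    \<comment> \<open>So far to the right that the tilt outweighs any rise of \<open>g\<close>,
      which is at most \<open>2 * B\<close>.\<close>
    define z where "z = a' + (2 * B + 1) / k"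
    have B0: "0 \<le> B" using B[of 0] by linarith
    then have z: "a' < z" using k by (simp add: z_def)
    have kz: "k * (z - a') = 2 * B + 1"
      using k by (simp add: z_def)
    \<comment> \<open>Small enough that the added parabola regains only \<open>k * (a' - a)\<close>
      at \<open>z\<close>, which leaves \<open>G z\<close> below \<open>G a\<close>.\<close>
    define c where "c = k * (a' - a) / (z - a)\<^sup>2"
    have c: "0 < c" using k z lt by (auto simp: c_def)
    have cz: "c * (z - a)\<^sup>2 = k * (a' - a)"
      using z lt by (simp add: c_def)
    define G where "G x = g x - k * (x - a) + c * (x - a)\<^sup>2" for x
    have contG: "continuous_on {a..z} G"
      unfolding G_def by (intro continuous_intros continuous_on_subset[OF g]) auto
    \<comment> \<open>The maximum is interior because \<open>G a'\<close> exceeds both end values;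
      comparing \<open>G\<close> around it gives the touching parabola.\<close>
    obtain x0 where x0: "x0 \<in> {a..z}" "\<And>y. y \<in> {a..z} \<Longrightarrow> G y \<le> G x0"
      using continuous_attains_sup[of "{a..z}" G] contG z lt by fastforce
    have kp: "k * (a' - a) > 0" using k lt by simp
    have "G a' = g a + k * (a' - a) + c * (a' - a)\<^sup>2"
      using k unfolding G_def by linarith
    then have Ga': "G a' > g a"
      using mult_nonneg_nonneg[of c "(a' - a)\<^sup>2"] c kp by (simp add: add_pos_nonneg)
    have "G a' \<le> G x0" using x0 z lt by auto
    moreover have "G a = g a" by (simp add: G_def)
    moreover have "G z < g a"
    proof -
      have "G z = g z - (k * (z - a') + k * (a' - a)) + k * (a' - a)"
        unfolding G_def cz by (simp add: algebra_simps)
      then have "G z = g z - (2 * B + 1)" using kz by simp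
      then show ?thesis using B[of z] B[of a] by linarith
    qed
    ultimately have ne: "x0 \<noteq> a" "x0 \<noteq> z" using Ga' by auto
    define r where "r = min (x0 - a) (z - x0)"
    have r: "0 < r" using ne x0 by (auto simp: r_def)
    have "g (x0 + h) \<le> g x0 + (k - 2 * c * (x0 - a)) * h - c * h\<^sup>2" if "\<bar>h\<bar> \<le> r" for h
    proof -
      have "x0 + h \<in> {a..z}" using that by (auto simp: r_def)
      from x0(2)[OF this] show ?thesis
        unfolding G_def by (simp add: power2_eq_square algebra_simps)
    qed
    then show ?thesis using r c by blast
  qed
  obtain a a' where a: "a < a'" "f a \<noteq> f a'"
    using ne by (metis linorder_neqE_linordered_idom)
  show thesis
  proof (cases "f a < f a'")
    case True
    from main[OF f B a(1) this] that show ?thesis by blast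
  next
    case False
    \<comment> \<open>Reflection turns the remaining case into the increasing one; reflecting back
      changes only the signs of \<open>x0\<close> and \<open>b\<close>.\<close>
    have "\<exists>x0 b c r. 0 < c \<and> 0 < r \<and>
        (\<forall>h. \<bar>h\<bar> \<le> r \<longrightarrow> f (- (x0 + h)) \<le> f (- x0) + b * h - c * h\<^sup>2)"
      by (rule main[of "\<lambda>x. f (- x)" B "- a'" "- a"])
        (use a False B f in \<open>auto intro!: continuous_on_compose2[OF f] continuous_intros\<close>)
    then obtain x0 b c r where *: "0 < c" "0 < r"
        "\<And>h. \<bar>h\<bar> \<le> r \<Longrightarrow> f (- (x0 + h)) \<le> f (- x0) + b * h - c * h\<^sup>2"
      by blast
    have "f (- x0 + h) \<le> f (- x0) + (- b) * h - c * h\<^sup>2" if "\<bar>h\<bar> \<le> r" for h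
      using *(3)[of "- h"] that by simp
    then show ?thesis using * that by blast
  qed
qed

lemma affine_if_second_deriv_zero:
  fixes v w :: "real \<Rightarrow> real"
  assumes "convex S" and v: "\<And>x. x \<in> S \<Longrightarrow> (v has_real_derivative w x) (at x)"
    and w: "\<And>x. x \<in> S \<Longrightarrow> (w has_real_derivative 0) (at x)"
    and x: "x \<in> S" "y \<in> S"
  shows "w y = w x" "v y = v x + w x * (y - x)"
proof -
  have "\<exists>k. \<forall>y\<in>S. w y = k"
    by (rule has_field_derivative_zero_constant[OF \<open>convex S\<close>])
      (rule has_field_derivative_at_within[OF w])
  with x have weq: "w y = w x" if "y \<in> S" for y
    using that by auto
  from weq[OF x(2)] show "w y = w x" .
  have "\<exists>k. \<forall>y\<in>S. v y - w x * y = k"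
  proof (rule has_field_derivative_zero_constant[OF \<open>convex S\<close>])
    fix y assume "y \<in> S"
    from v[OF this] weq[OF this] have "((\<lambda>y. v y - w x * y) has_real_derivative 0) (at y)"
      by (auto intro!: derivative_eq_intros)
    then show "((\<lambda>y. v y - w x * y) has_real_derivative 0) (at y within S)"
      by (rule has_field_derivative_at_within)
  qed
  with x show "v y = v x + w x * (y - x)"
    by (auto simp: algebra_simps)
qed

section \<open>Chain rule, fixed points and one-sided derivatives\<close>

lemma has_real_derivative_compose_pair:
  fixes f :: "real \<Rightarrow> real \<Rightarrow> real"
  assumes "((\<lambda>z. f (fst z) (snd z)) has_derivative (\<lambda>h. a * fst h + b * snd h)) (at (x y, s y))"
    and "(x has_real_derivative x') (at y)" "(s has_real_derivative s') (at y)"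
  shows "((\<lambda>y. f (x y) (s y)) has_real_derivative a * x' + b * s') (at y)"
proof -
  have "((\<lambda>y. (x y, s y)) has_derivative (\<lambda>h. (x' * h, s' * h))) (at y)"
    using assms(2,3) by (intro has_derivative_Pair) (auto simp: has_field_derivative_def)
  from has_derivative_compose[OF this assms(1)] show ?thesis
    by (auto simp: has_field_derivative_def algebra_simps
        elim!: has_derivative_eq_rhs)
qed

text \<open>The parameter \<open>l\<close> unites two problems: \<open>l = 0\<close> prescribes the
  initial data \<open>a\<close> and \<open>b\<close>, while \<open>l = 1 / d\<close> removes
  \<open>k\<close> from the last equation and prescribes the end value \<open>a + b * d\<close>.
  Clamping time to the window gives a contraction of the bounded continuous functions on the line
  and a solution defined for all times.\<close>

lemma second_order_fixed_point:
  fixes F :: "real \<Rightarrow> real \<Rightarrow> real"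
  assumes F: "continuous_on UNIV (\<lambda>z. F (fst z) (snd z))"
    and lip: "\<And>y a b. \<bar>F y a - F y b\<bar> \<le> L * \<bar>a - b\<bar>"
    and d: "0 < d" and small: "4 * L * d\<^sup>2 \<le> 1" and l: "0 \<le> l" "l * d \<le> 1"
  obtains v w k where "\<And>y. (v has_real_derivative w y) (at y)"
    and "\<And>y. (w has_real_derivative - F (max 0 (min d y)) (v (max 0 (min d y)))) (at y)"
    and "v 0 = a" and "w 0 = b + l * k" and "v d = a + b * d + (l * d - 1) * k"
proof -
  define cl where "cl y = max 0 (min d y)" for y
  have cl: "cl y \<in> {0..d}" "y \<in> {0..d} \<Longrightarrow> cl y = y" for y
    using d by (auto simp: cl_def)
  have contcl: "continuous_on UNIV cl"
    unfolding cl_def by (intro continuous_intros)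
  have L: "0 \<le> L" using lip[of 0 1 0] by simp
  define \<psi> where "\<psi> h y = F (cl y) (apply_bcontfun h (cl y))" for h y
  have cont\<psi>: "continuous_on UNIV (\<psi> h)" for h
  proof -
    have "continuous_on UNIV (\<lambda>y. (cl y, apply_bcontfun h (cl y)))"
      using continuous_on_compose[OF contcl continuous_on_apply_bcontfun[of "cl ` UNIV" h]] contcl
      by (intro continuous_on_Pair) (simp_all add: o_def)
    from continuous_on_compose[OF this continuous_on_subset[OF F]] show ?thesis
      by (simp add: \<psi>_def o_def)
  qed
  have "\<exists>P A. (\<forall>y. (P has_real_derivative A y) (at y)) \<and> (\<forall>y. (A has_real_derivative \<psi> h y) (at y))
      \<and> P 0 = 0 \<and> A 0 = 0" for h
  proof -
    obtain A where A: "\<And>y. (A has_real_derivative \<psi> h y) (at y)" "A 0 = 0"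
      using antiderivative_UNIV[OF cont\<psi>] by blast
    moreover obtain P where "\<And>y. (P has_real_derivative A y) (at y)" "P 0 = 0"
      using antiderivative_UNIV[OF has_real_derivative_imp_continuous_on[OF A(1)]] by blast
    ultimately show ?thesis by blast
  qed
  then obtain P A where P: "\<And>h y. (P h has_real_derivative A h y) (at y)"
    and A: "\<And>h y. (A h has_real_derivative \<psi> h y) (at y)"
    and P0: "\<And>h. P h 0 = 0" and A0: "\<And>h. A h 0 = 0"
    by metis
  \<comment> \<open>\<open>P h\<close> is the double integral of the force, and the term with
    \<open>l\<close> corrects the initial velocity.\<close>
  define V where "V h y = a + b * y + l * y * P h d - P h y" for h y
  have V: "(V h has_real_derivative (b + l * P h d - A h y)) (at y)" for h y
    unfolding V_def by (auto intro!: derivative_eq_intros P)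
  have contV: "continuous_on S (V h)" for S h
    by (rule has_real_derivative_imp_continuous_on[OF V])
  have Vcl: "(\<lambda>y. V h (cl y)) \<in> bcontfun" for h
  proof -
    have "compact (V h ` {0..d})"
      by (intro compact_continuous_image contV) auto
    moreover have "range (\<lambda>y. V h (cl y)) \<subseteq> V h ` {0..d}"
      using cl by auto
    ultimately show ?thesis
      by (auto simp: bcontfun_def intro!: continuous_on_compose2[OF contV contcl]
          intro: bounded_subset compact_imp_bounded)
  qed
  define T where "T h = Bcontfun (\<lambda>y. V h (cl y))" for h
  have T: "apply_bcontfun (T h) y = V h (cl y)" for h y
    unfolding T_def using Vcl by (simp add: Bcontfun_inverse)
  have diff\<psi>: "\<bar>\<psi> g y - \<psi> h y\<bar> \<le> L * dist g h" for g h y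
    unfolding \<psi>_def
    using lip[of "cl y" "apply_bcontfun g (cl y)" "apply_bcontfun h (cl y)"]
      mult_left_mono[OF dist_bounded[of g "cl y" h] L]
    by (simp add: dist_real_def)
  have diffP: "\<bar>P g y - P h y\<bar> \<le> L * dist g h * d\<^sup>2" if "y \<in> {0..d}" for g h y
  proof -
    have "\<bar>A g y - A h y\<bar> \<le> L * dist g h * d" if "y \<in> {0..d}" for y
      by (rule deriv_bound_from_zero[of d _ "\<lambda>y. \<psi> g y - \<psi> h y" _ 0])
        (use that d A0 diff\<psi> in \<open>auto intro!: derivative_eq_intros A\<close>)
    from this have "\<bar>P g y - P h y\<bar> \<le> L * dist g h * d * d"
      by (rule deriv_bound_from_zero[of d _ "\<lambda>y. A g y - A h y" _ 0, rotated])
        (use that d P0 in \<open>auto intro!: derivative_eq_intros P\<close>)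
    then show ?thesis by (simp add: power2_eq_square algebra_simps)
  qed
  have "dist (T g) (T h) \<le> 1 / 2 * dist g h" for g h
  proof (rule dist_bound)
    fix y
    \<comment> \<open>The velocity correction and the double integral each contribute at most
      \<open>L * d^2\<close> times the distance; together this is at most one half of it.\<close>
    have "\<bar>V g (cl y) - V h (cl y)\<bar> \<le> \<bar>l * cl y * (P g d - P h d)\<bar> + \<bar>P g (cl y) - P h (cl y)\<bar>"
      unfolding V_def by (simp add: algebra_simps)
    also have "\<bar>l * cl y * (P g d - P h d)\<bar> \<le> 1 * (L * dist g h * d\<^sup>2)"
    proof -
      have "l * cl y \<le> l * d" using cl(1)[of y] l by (intro mult_left_mono) auto
      then have "\<bar>l * cl y\<bar> \<le> 1" using l cl(1)[of y] by (auto simp: abs_mult)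
      then show ?thesis unfolding abs_mult[of "l * cl y"]
        using diffP[of d g h] d by (intro mult_mono) auto
    qed
    also have "\<bar>P g (cl y) - P h (cl y)\<bar> \<le> L * dist g h * d\<^sup>2"
      using diffP cl by blast
    also have "1 * (L * dist g h * d\<^sup>2) + L * dist g h * d\<^sup>2 = (4 * L * d\<^sup>2) * (dist g h / 2)"
      by (simp add: algebra_simps)
    also have "\<dots> \<le> 1 * (dist g h / 2)"
      by (intro mult_right_mono small) auto
    finally show "dist (apply_bcontfun (T g) y) (apply_bcontfun (T h) y) \<le> 1 / 2 * dist g h"
      by (simp add: T dist_real_def)
  qed
  then obtain h where h: "T h = h"
    using banach_fix_type[of "1/2" T] by auto
  show thesis
  proof (rule that)
    show "\<And>y. (V h has_real_derivative (b + l * P h d - A h y)) (at y)" by (rule V)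
    have "\<psi> h y = F (cl y) (V h (cl y))" for y
      using T[of h "cl y"] cl by (simp add: h \<psi>_def)
    then show "\<And>y. ((\<lambda>y. b + l * P h d - A h y) has_real_derivative
        - F (max 0 (min d y)) (V h (max 0 (min d y)))) (at y)"
      unfolding cl_def[symmetric] by (auto intro!: derivative_eq_intros A)
    show "V h 0 = a" "b + l * P h d - A h 0 = b + l * P h d"
      "V h d = a + b * d + (l * d - 1) * P h d"
      by (auto simp: V_def P0 A0 algebra_simps)
  qed
qed

text \<open>At the edge \<open>|x| = U\<close> the function is known to vanish on one side only, but
  the derivative from that side already determines \<open>D\<close>.\<close>

lemma deriv_zero_outside_interval:
  fixes f :: "real \<Rightarrow> real"
  assumes f: "(f has_real_derivative D) (at x)" and zero: "\<And>y. U \<le> \<bar>y\<bar> \<Longrightarrow> f y = 0"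
    and x: "U \<le> \<bar>x\<bar>" and "0 < U"
  shows "D = 0"
proof -
  define S where "S = (if 0 < x then {x..x + 1} else {x - 1..x})"
  have S: "x \<in> S" "S \<subseteq> {y. U \<le> \<bar>y\<bar>}" "at x within S \<noteq> bot"
    using x \<open>0 < U\<close> by (auto simp: S_def at_within_Icc_at_right at_within_Icc_at_left)
  have "(f has_real_derivative D) (at x within S)"
    using f by (rule has_field_derivative_at_within)
  moreover have "(f has_real_derivative 0) (at x within S)"
    by (rule has_field_derivative_transform_within[of "\<lambda>_. 0" _ _ _ 1])
      (use S zero in auto)
  ultimately show ?thesis
    using S(3) by (rule has_field_derivative_unique)
qed

lemma continuous_on_compose_pair:
  assumes "continuous_on UNIV (\<lambda>z. f (fst z) (snd z))" "continuous_on S x" "continuous_on S s"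
  shows "continuous_on S (\<lambda>y. f (x y) (s y))"
  using continuous_on_compose2[OF assms(1) continuous_on_Pair[OF assms(2,3)]] by simp

section \<open>Trajectories crossing the strip\<close>

text \<open>\<open>E\<close> includes the factor e^(2t), so the force is \<open>- Eu\<close>. The
  shared \<open>Eut\<close> in the derivatives of \<open>Eu\<close> and \<open>Et\<close> encodes
  the symmetry of mixed partials. The exponential bound controls the far past in the integration
  over starting times.\<close>

locale strip_potential =
  fixes E Eu Et Euu Eut Ett :: "real \<Rightarrow> real \<Rightarrow> real" and U T C :: real
  assumes U_pos: "0 < U" and C_pos: "0 < C"
    and dE: "\<And>u t. ((\<lambda>z. E (fst z) (snd z)) has_derivative
        (\<lambda>h. Eu u t * fst h + Et u t * snd h)) (at (u, t))"
    and dEu: "\<And>u t. ((\<lambda>z. Eu (fst z) (snd z)) has_derivative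
        (\<lambda>h. Euu u t * fst h + Eut u t * snd h)) (at (u, t))"
    and dEt: "\<And>u t. ((\<lambda>z. Et (fst z) (snd z)) has_derivative
        (\<lambda>h. Eut u t * fst h + Ett u t * snd h)) (at (u, t))"
    and cont_Euu: "continuous_on UNIV (\<lambda>z. Euu (fst z) (snd z))"
    and cont_Eut: "continuous_on UNIV (\<lambda>z. Eut (fst z) (snd z))"
    and cont_Ett: "continuous_on UNIV (\<lambda>z. Ett (fst z) (snd z))"
    and supp_u: "\<And>u t. U \<le> \<bar>u\<bar> \<Longrightarrow> E u t = 0"
    and supp_t: "\<And>u t. T < t \<Longrightarrow> E u t = 0"
    and E_bound: "\<And>u t. \<bar>E u t\<bar> \<le> C" and E_decay: "\<And>u t. \<bar>E u t\<bar> \<le> C * exp t"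
    and Eu_bound: "\<And>u t. \<bar>Eu u t\<bar> \<le> C" and Et_bound: "\<And>u t. \<bar>Et u t\<bar> \<le> C"
    and Euu_bound: "\<And>u t. \<bar>Euu u t\<bar> \<le> C" and Eut_bound: "\<And>u t. \<bar>Eut u t\<bar> \<le> C"
begin

section \<open>Support, continuity and Lipschitz bounds of the potential\<close>

lemmas E_comp = has_real_derivative_compose_pair[of E, OF dE]
lemmas Eu_comp = has_real_derivative_compose_pair[of Eu, OF dEu]
lemmas Et_comp = has_real_derivative_compose_pair[of Et, OF dEt]

lemma E_deriv_u: "((\<lambda>u. E u t) has_real_derivative Eu u t) (at u)"
  using E_comp[of "\<lambda>u. u" 1 u "\<lambda>_. t" 0] by (auto intro: derivative_eq_intros)

lemma E_deriv_t: "(E u has_real_derivative Et u t) (at t)"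
  using E_comp[of "\<lambda>_. u" 0 t "\<lambda>t. t" 1] by (auto intro: derivative_eq_intros)

lemma Eu_deriv_u: "((\<lambda>u. Eu u t) has_real_derivative Euu u t) (at u)"
  using Eu_comp[of "\<lambda>u. u" 1 u "\<lambda>_. t" 0] by (auto intro: derivative_eq_intros)

lemma Eu_deriv_t: "(Eu u has_real_derivative Eut u t) (at t)"
  using Eu_comp[of "\<lambda>_. u" 0 t "\<lambda>t. t" 1] by (auto intro: derivative_eq_intros)

lemma Eu_outside: "U \<le> \<bar>u\<bar> \<Longrightarrow> Eu u t = 0"
  using deriv_zero_outside_interval[OF E_deriv_u supp_u _ U_pos] by blast

lemma Euu_outside: "U \<le> \<bar>u\<bar> \<Longrightarrow> Euu u t = 0"
  using deriv_zero_outside_interval[OF Eu_deriv_u Eu_outside _ U_pos] by blast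

lemma Et_outside: "U \<le> \<bar>u\<bar> \<Longrightarrow> Et u t = 0"
proof -
  assume "U \<le> \<bar>u\<bar>"
  then have "E u = (\<lambda>_. 0)" using supp_u by auto
  then show ?thesis using E_deriv_t[of u t] DERIV_unique[of "\<lambda>_. 0" _ t 0] by auto
qed

lemma cont_E: "continuous_on UNIV (\<lambda>z. E (fst z) (snd z))"
  using dE by (auto intro!: continuous_at_imp_continuous_on has_derivative_continuous)

lemma cont_Eu: "continuous_on UNIV (\<lambda>z. Eu (fst z) (snd z))"
  using dEu by (auto intro!: continuous_at_imp_continuous_on has_derivative_continuous)

lemma cont_Et: "continuous_on UNIV (\<lambda>z. Et (fst z) (snd z))"
  using dEt by (auto intro!: continuous_at_imp_continuous_on has_derivative_continuous)

lemmas cont_comp =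
  cont_E[THEN continuous_on_compose_pair] cont_Eu[THEN continuous_on_compose_pair]
  cont_Et[THEN continuous_on_compose_pair] cont_Euu[THEN continuous_on_compose_pair]
  cont_Eut[THEN continuous_on_compose_pair] cont_Ett[THEN continuous_on_compose_pair]

lemma E_lipschitz_t: "\<bar>E u t - E u t'\<bar> \<le> C * \<bar>t - t'\<bar>"
  using field_differentiable_bound[of UNIV "E u" "Et u" C t t'] E_deriv_t Et_bound by auto

lemma E_lipschitz_u: "\<bar>E u t - E u' t\<bar> \<le> C * \<bar>u - u'\<bar>"
  using field_differentiable_bound[of UNIV "\<lambda>u. E u t" "\<lambda>u. Eu u t" C u u'] E_deriv_u Eu_bound by auto

lemma Eu_lipschitz_u: "\<bar>Eu u t - Eu u' t\<bar> \<le> C * \<bar>u - u'\<bar>"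
  using field_differentiable_bound[of UNIV "\<lambda>u. Eu u t" "\<lambda>u. Euu u t" C u u'] Eu_deriv_u Euu_bound by auto

lemma Eu_lipschitz_t: "\<bar>Eu u t - Eu u t'\<bar> \<le> C * \<bar>t - t'\<bar>"
  using field_differentiable_bound[of UNIV "Eu u" "Eut u" C t t'] Eu_deriv_t Eut_bound by auto

text \<open>Taylor's formula along the segment. All three second partials are taken at one point of
  it, so their moduli of continuity control the error.\<close>

lemma E_taylor:
  obtains \<theta> where "0 \<le> \<theta>" "\<theta> \<le> 1"
    "E (a + h) (t + k) = E a t + Eu a t * h + Et a t * k +
      (Euu (a + \<theta> * h) (t + \<theta> * k) * h\<^sup>2 + 2 * Eut (a + \<theta> * h) (t + \<theta> * k) * h * k +
       Ett (a + \<theta> * h) (t + \<theta> * k) * k\<^sup>2) / 2"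
proof -
  define x s where "x \<theta> = a + \<theta> * h" and "s \<theta> = t + \<theta> * k" for \<theta>
  define g where "g \<theta> = E (x \<theta>) (s \<theta>)" for \<theta>
  define g1 where "g1 \<theta> = Eu (x \<theta>) (s \<theta>) * h + Et (x \<theta>) (s \<theta>) * k" for \<theta>
  define g2 where "g2 \<theta> = Euu (x \<theta>) (s \<theta>) * h\<^sup>2 + 2 * Eut (x \<theta>) (s \<theta>) * h * k + Ett (x \<theta>) (s \<theta>) * k\<^sup>2" for \<theta>
  have x: "(x has_real_derivative h) (at \<theta>)" and s: "(s has_real_derivative k) (at \<theta>)" for \<theta>
    unfolding x_def s_def by (auto intro!: derivative_eq_intros)
  have g: "(g has_real_derivative g1 \<theta>) (at \<theta>)" for \<theta>
    unfolding g_def g1_def by (rule E_comp[OF x s])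
  have g1: "(g1 has_real_derivative g2 \<theta>) (at \<theta>)" for \<theta>
    unfolding g1_def g2_def
    by (auto intro!: derivative_eq_intros Eu_comp[OF x s] Et_comp[OF x s]
        simp: power2_eq_square algebra_simps)
  define D where "D m = (if m = 0 then g else if m = 1 then g1 else g2)" for m :: nat
  have "\<exists>\<theta>>0. \<theta> < 1 \<and> g 1 = (\<Sum>m<2. D m 0 / fact m * 1 ^ m) + D 2 \<theta> / fact 2 * 1 ^ 2"
  proof (rule Maclaurin)
    show "\<forall>m t. m < 2 \<and> 0 \<le> t \<and> t \<le> 1 \<longrightarrow> (D m has_real_derivative D (Suc m) t) (at t)"
      using g g1 by (auto simp: D_def less_2_cases_iff)
  qed (auto simp: D_def)
  then obtain \<theta> where "0 < \<theta>" "\<theta> < 1" "g 1 = g 0 + g1 0 + g2 \<theta> / 2"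
    by (auto simp: D_def numeral_2_eq_2)
  then show thesis
    by (intro that[of \<theta>]) (auto simp: g_def g1_def g2_def x_def s_def)
qed

lemma E_taylor_upper: "E x t \<le> E a t + Eu a t * (x - a) + C / 2 * (x - a)\<^sup>2"
proof -
  obtain \<theta> where "E (a + (x - a)) (t + 0) = E a t + Eu a t * (x - a) + Et a t * 0 +
      (Euu (a + \<theta> * (x - a)) (t + \<theta> * 0) * (x - a)\<^sup>2 + 2 * Eut (a + \<theta> * (x - a)) (t + \<theta> * 0) * (x - a) * 0 +
       Ett (a + \<theta> * (x - a)) (t + \<theta> * 0) * 0\<^sup>2) / 2"
    by (rule E_taylor)
  moreover have "Euu (a + \<theta> * (x - a)) t * (x - a)\<^sup>2 \<le> C * (x - a)\<^sup>2"
    using Euu_bound[of "a + \<theta> * (x - a)" t] by (intro mult_right_mono) auto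
  ultimately show ?thesis by simp
qed

text \<open>The argument of \<open>v\<close> and \<open>w\<close> is the time elapsed since \<open>s\<close>.\<close>

definition crossing :: "real \<Rightarrow> real \<Rightarrow> (real \<Rightarrow> real) \<Rightarrow> (real \<Rightarrow> real) \<Rightarrow> bool" where
  "crossing d s v w \<longleftrightarrow>
     (\<forall>y. (v has_real_derivative w y) (at y)) \<and>
     (\<forall>y. (w has_real_derivative - Eu (v y) (s + y)) (at y)) \<and>
     v 0 = - U \<and> v d = U \<and> (\<forall>y\<le>0. v y \<le> - U) \<and> (\<forall>y\<ge>d. U \<le> v y)"

text \<open>The first bound provides the contractions, the positivity of the Dirichlet index form
  and the absorption argument in \<open>crossing_lipschitz\<close>; the second keeps the velocity
  positive, so that the trajectory leaves the strip for good.\<close>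

definition short :: "real \<Rightarrow> bool" where
  "short d \<longleftrightarrow> 0 < d \<and> 8 * C * d\<^sup>2 \<le> 1 \<and> C * d\<^sup>2 < U"

text \<open>The deviation from uniform motion vanishes at both ends and has acceleration at most
  \<open>C\<close>.\<close>

lemma crossing_near_line:
  assumes d: "0 < d"
    and v: "\<And>y. y \<in> {0..d} \<Longrightarrow> (v has_real_derivative w y) (at y)"
    and w: "\<And>y. y \<in> {0..d} \<Longrightarrow> (w has_real_derivative - Eu (v y) (s + y)) (at y)"
    and "v 0 = - U" "v d = U" "y \<in> {0..d}"
  shows "\<bar>w y - 2 * U / d\<bar> \<le> C * d" "\<bar>v y - (- U + 2 * U / d * y)\<bar> \<le> C * d\<^sup>2"
proof -
  have "((\<lambda>y. v y - (- U + 2 * U / d * y)) has_real_derivative (w y - 2 * U / d)) (at y)"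
    if "y \<in> {0..d}" for y
    using v[OF that] d by (auto intro!: derivative_eq_intros)
  moreover have "((\<lambda>y. w y - 2 * U / d) has_real_derivative - Eu (v y) (s + y)) (at y)"
    if "y \<in> {0..d}" for y
    using w[OF that] by (auto intro!: derivative_eq_intros)
  ultimately show "\<bar>w y - 2 * U / d\<bar> \<le> C * d" "\<bar>v y - (- U + 2 * U / d * y)\<bar> \<le> C * d\<^sup>2"
    using second_deriv_bound_dirichlet[of d "\<lambda>y. v y - (- U + 2 * U / d * y)" "\<lambda>y. w y - 2 * U / d"
        "\<lambda>y. - Eu (v y) (s + y)" C y] assms(1,4-6) Eu_bound
    by simp_all
qed

text \<open>The case \<open>l = 1 / d\<close> of the fixed point lemma yields a solution for the
  clamped force. At \<open>- U\<close> and \<open>U\<close> the force is zero, so outside the window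
  this solution is affine; its velocity is positive, so it stays outside the strip, where the true
  force vanishes as well.\<close>

lemma crossing_exists:
  assumes "short d"
  obtains v w where "crossing d s v w"
proof -
  have d: "0 < d" "8 * C * d\<^sup>2 \<le> 1" "C * d\<^sup>2 < U" using assms by (auto simp: short_def)
  define cl where "cl y = max 0 (min d y)" for y
  have "continuous_on UNIV (\<lambda>z. Eu (snd z) (s + fst z))"
    by (intro cont_comp continuous_intros)
  then obtain v w k where v: "\<And>y. (v has_real_derivative w y) (at y)"
    and w: "\<And>y. (w has_real_derivative - Eu (v (cl y)) (s + cl y)) (at y)"
    and v0: "v 0 = - U" and vd: "v d = - U + 2 * U / d * d + (1 / d * d - 1) * k"
    unfolding cl_def
    by (rule second_order_fixed_point[of "\<lambda>y a. Eu a (s + y)" C d "1 / d" "- U" "2 * U / d"])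
      (use Eu_lipschitz_u d mult_nonneg_nonneg[of C "d\<^sup>2"] C_pos in auto)
  have vd: "v d = U" using vd d by simp
  have w': "(w has_real_derivative - Eu (v y) (s + y)) (at y)" if "y \<in> {0..d}" for y
    using w[of y] that by (simp add: cl_def)
  have w_pos: "0 < w y" if "y \<in> {0..d}" for y
  proof -
    \<comment> \<open>The mean velocity exceeds the largest deviation that
      \<open>crossing_near_line\<close> permits.\<close>
    have "C * d < 2 * U / d" using d U_pos by (simp add: field_simps power2_eq_square)
    then show ?thesis using crossing_near_line(1)[OF d(1) v w' v0 vd that] by linarith
  qed
  have left: "v y \<le> - U" if "y \<le> 0" for y
  proof -
    have "(w has_real_derivative 0) (at y)" if "y \<in> {..0}" for y
      using w[of y] that d v0 Eu_outside[of "- U"] by (simp add: cl_def)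
    then have "v y = v 0 + w 0 * (y - 0)"
      using that by (intro affine_if_second_deriv_zero[of "{..0}"] v) auto
    then show ?thesis using v0 w_pos[of 0] d that by (simp add: mult_nonneg_nonpos)
  qed
  have right: "U \<le> v y" if "d \<le> y" for y
  proof -
    have "(w has_real_derivative 0) (at y)" if "y \<in> {d..}" for y
      using w[of y] that d vd Eu_outside[of U] by (simp add: cl_def)
    then have "v y = v d + w d * (y - d)"
      using that by (intro affine_if_second_deriv_zero[of "{d..}"] v) auto
    then show ?thesis using vd w_pos[of d] d that by simp
  qed
  have "(w has_real_derivative - Eu (v y) (s + y)) (at y)" for y
  proof -
    consider "y \<in> {0..d}" | "y < 0" | "d < y" by fastforce
    then show ?thesis
    proof cases
      case 2
      then have "cl y = 0" "Eu (v y) (s + y) = 0"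
        using d left[of y] U_pos by (auto simp: cl_def intro!: Eu_outside)
      then show ?thesis using w[of y] v0 U_pos Eu_outside[of "- U"] by simp
    next
      case 3
      then have "cl y = d" "Eu (v y) (s + y) = 0"
        using d right[of y] U_pos by (auto simp: cl_def intro!: Eu_outside)
      then show ?thesis using w[of y] vd U_pos Eu_outside[of U] by simp
    qed (rule w')
  qed
  with v v0 vd left right have "crossing d s v w"
    unfolding crossing_def by blast
  then show thesis by (rule that)
qed

section \<open>The action and its minimality\<close>

definition action :: "real \<Rightarrow> real \<Rightarrow> (real \<Rightarrow> real) \<Rightarrow> (real \<Rightarrow> real) \<Rightarrow> real" where
  "action d s x x' = integral {0..d} (\<lambda>y. (x' y)\<^sup>2 / 2 - E (x y) (s + y))"

lemma crossing_continuous: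
  assumes "crossing d s v w"
  shows "continuous_on S v" "continuous_on S w"
  using assms has_real_derivative_imp_continuous_on[of S v w]
    has_real_derivative_imp_continuous_on[of S w "\<lambda>y. - Eu (v y) (s + y)"]
  by (auto simp: crossing_def)

lemma action_integrable:
  assumes "continuous_on {0..d} x" "continuous_on {0..d} x'"
  shows "(\<lambda>y. (x' y)\<^sup>2 / 2 - E (x y) (s + y)) integrable_on {0..d}"
  by (intro integrable_continuous_interval continuous_intros cont_comp assms) auto

text \<open>The first variation at \<open>v\<close> vanishes because the field \<open>x - v\<close>
  is zero at the ends. The second order part of \<open>E\<close> is estimated from above by the
  constant \<open>C\<close>, which leaves an explicit index form.\<close>

lemma action_gap:
  assumes d: "0 < d" and cr: "crossing d s v w"
    and x: "\<And>y. y \<in> {0..d} \<Longrightarrow> (x has_real_derivative x' y) (at y)"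
    and x': "continuous_on {0..d} x'" and x_ends: "x 0 = - U" "x d = U"
  shows "integral {0..d} (\<lambda>y. (x' y - w y)\<^sup>2 - C * (x y - v y)\<^sup>2) / 2
    \<le> action d s x x' - action d s v w"
proof -
  have v: "(v has_real_derivative w y) (at y)" and w: "(w has_real_derivative - Eu (v y) (s + y)) (at y)"
    and v_ends: "v 0 = - U" "v d = U" for y
    using cr by (auto simp: crossing_def)
  note cont = crossing_continuous[OF cr] has_real_derivative_imp_continuous_on[OF x] x'
  \<comment> \<open>The first variation, written as the derivative of
    \<open>w * (x - v)\<close>.\<close>
  have "((\<lambda>y. w y * (x' y - w y) - Eu (v y) (s + y) * (x y - v y)) has_integral
      (w d * (x d - v d) - w 0 * (x 0 - v 0))) {0..d}"
    using d by (intro integral_deriv_real) (auto intro!: derivative_eq_intros v w x)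
  then have i1: "((\<lambda>y. w y * (x' y - w y) - Eu (v y) (s + y) * (x y - v y)) has_integral 0) {0..d}"
    by (simp add: x_ends v_ends)
  have "(\<lambda>y. (x' y - w y)\<^sup>2 - C * (x y - v y)\<^sup>2) integrable_on {0..d}"
    by (intro integrable_continuous_interval continuous_intros cont)
  from has_integral_add[OF has_integral_divide[OF integrable_integral[OF this], of 2] i1]
  have "((\<lambda>y. ((x' y - w y)\<^sup>2 - C * (x y - v y)\<^sup>2) / 2 +
        (w y * (x' y - w y) - Eu (v y) (s + y) * (x y - v y))) has_integral
      (integral {0..d} (\<lambda>y. (x' y - w y)\<^sup>2 - C * (x y - v y)\<^sup>2) / 2)) {0..d}"
    by simp
  moreover have "((\<lambda>y. ((x' y)\<^sup>2 / 2 - E (x y) (s + y)) - ((w y)\<^sup>2 / 2 - E (v y) (s + y)))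
      has_integral (action d s x x' - action d s v w)) {0..d}"
    unfolding action_def
    by (intro has_integral_diff integrable_integral action_integrable cont) auto
  ultimately show ?thesis
  proof (rule has_integral_le)
    fix y assume "y \<in> {0..d}"
    show "((x' y - w y)\<^sup>2 - C * (x y - v y)\<^sup>2) / 2 +
          (w y * (x' y - w y) - Eu (v y) (s + y) * (x y - v y))
        \<le> ((x' y)\<^sup>2 / 2 - E (x y) (s + y)) - ((w y)\<^sup>2 / 2 - E (v y) (s + y))"
      using E_taylor_upper[of "x y" "s + y" "v y"]
      by (simp add: power2_eq_square field_simps)
  qed
qed

text \<open>On a short window the index form is nonnegative even with \<open>2 * C\<close> in place
  of \<open>C\<close>. The reserve bounds the action gap below by a multiple of the squared
  distance, which gives minimality and uniqueness together.\<close>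

lemma action_minimal:
  assumes "short d" and cr: "crossing d s v w"
    and x: "\<And>y. y \<in> {0..d} \<Longrightarrow> (x has_real_derivative x' y) (at y)"
    and x': "continuous_on {0..d} x'" and x_ends: "x 0 = - U" "x d = U"
  shows "action d s v w \<le> action d s x x'"
    and "action d s x x' = action d s v w \<Longrightarrow> y \<in> {0..d} \<Longrightarrow> x y = v y"
proof -
  have d: "0 < d" "8 * (C * d\<^sup>2) \<le> 1" using assms(1) by (auto simp: short_def)
  have v: "(v has_real_derivative w y) (at y)" "v 0 = - U" "v d = U" for y
    using cr by (auto simp: crossing_def)
  note cont = crossing_continuous[OF cr] has_real_derivative_imp_continuous_on[OF x] x'
  have z: "((\<lambda>y. x y - v y) has_real_derivative x' y - w y) (at y)" if "y \<in> {0..d}" for y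
    using that by (auto intro!: derivative_eq_intros x v)
  have 1: "0 \<le> integral {0..d} (\<lambda>y. (x' y - w y)\<^sup>2 - 2 * C * (x y - v y)\<^sup>2)"
    using d C_pos v x_ends by (intro dirichlet_index_form_nonneg z continuous_intros cont) auto
  have i: "(\<lambda>y. (x' y - w y)\<^sup>2 - 2 * C * (x y - v y)\<^sup>2) integrable_on {0..d}"
    "(\<lambda>y. C * (x y - v y)\<^sup>2) integrable_on {0..d}"
    by (auto intro!: integrable_continuous_interval continuous_intros cont)
  have "integral {0..d} (\<lambda>y. (x' y - w y)\<^sup>2 - 2 * C * (x y - v y)\<^sup>2)
      + integral {0..d} (\<lambda>y. C * (x y - v y)\<^sup>2)
      = integral {0..d} (\<lambda>y. (x' y - w y)\<^sup>2 - C * (x y - v y)\<^sup>2)"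
    by (subst Henstock_Kurzweil_Integration.integral_add[OF i, symmetric]) (simp add: algebra_simps)
  with 1 action_gap[OF d(1) cr x x' x_ends]
  have 2: "integral {0..d} (\<lambda>y. C * (x y - v y)\<^sup>2) / 2 \<le> action d s x x' - action d s v w"
    by linarith
  have 3: "0 \<le> integral {0..d} (\<lambda>y. C * (x y - v y)\<^sup>2)"
    using C_pos by (intro integral_nonneg i) auto
  show "action d s v w \<le> action d s x x'" using 2 3 by linarith
  assume "action d s x x' = action d s v w" and y: "y \<in> {0..d}"
  then have "integral {0..d} (\<lambda>y. C * (x y - v y)\<^sup>2) = 0" using 2 3 by linarith
  then have "\<forall>y\<in>{0..d}. C * (x y - v y)\<^sup>2 = 0"
    using C_pos d by (subst (asm) integral_eq_0_iff) (auto intro!: continuous_intros cont)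
  then show "x y = v y" using y C_pos by auto
qed

text \<open>The difference of two crossings has zero end values, and its acceleration is at most
  \<open>C\<close> times the sum of its maximum and the time shift; on a short window the maximum is
  absorbed. Hence finite differences in \<open>s\<close> are first order variations.\<close>

lemma crossing_lipschitz:
  assumes "short d" and cr: "crossing d s v w" "crossing d s' v' w'" and y: "y \<in> {0..d}"
  shows "\<bar>v y - v' y\<bar> \<le> \<bar>s - s'\<bar>"
proof -
  have d: "0 < d" "8 * (C * d\<^sup>2) \<le> 1" using assms(1) by (auto simp: short_def)
  have "continuous_on {0..d} (\<lambda>y. \<bar>v y - v' y\<bar>)"
    by (intro continuous_intros crossing_continuous[OF cr(1)] crossing_continuous[OF cr(2)])
  then obtain m where m: "m \<in> {0..d}" "\<And>y. y \<in> {0..d} \<Longrightarrow> \<bar>v y - v' y\<bar> \<le> \<bar>v m - v' m\<bar>"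
    using continuous_attains_sup[of "{0..d}" "\<lambda>y. \<bar>v y - v' y\<bar>"] d by auto
  define M where "M = \<bar>v m - v' m\<bar>"
  have B: "\<bar>Eu (v' y) (s' + y) - Eu (v y) (s + y)\<bar> \<le> C * (M + \<bar>s - s'\<bar>)" if "y \<in> {0..d}" for y
  proof -
    have "\<bar>Eu (v' y) (s' + y) - Eu (v y) (s + y)\<bar> \<le> C * \<bar>v' y - v y\<bar> + C * \<bar>s - s'\<bar>"
      using Eu_lipschitz_u[of "v' y" "s' + y" "v y"] Eu_lipschitz_t[of "v y" "s' + y" "s + y"]
      by (auto simp: abs_minus_commute)
    also have "C * \<bar>v' y - v y\<bar> \<le> C * M"
      using m(2)[OF that] C_pos by (simp add: M_def abs_minus_commute)
    finally show ?thesis by (simp add: algebra_simps)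
  qed
  have "\<bar>v m - v' m\<bar> \<le> C * (M + \<bar>s - s'\<bar>) * d\<^sup>2"
    using cr m(1) unfolding crossing_def
    by (intro second_deriv_bound_dirichlet(2)[OF d(1), of _ "\<lambda>y. w y - w' y"
          "\<lambda>y. Eu (v' y) (s' + y) - Eu (v y) (s + y)"] B)
      (auto intro!: derivative_eq_intros)
  also have "\<dots> = (C * d\<^sup>2) * (M + \<bar>s - s'\<bar>)" by simp
  also have "\<dots> \<le> 1 / 8 * (M + \<bar>s - s'\<bar>)"
    using d by (intro mult_right_mono) (auto simp: M_def)
  finally have "7 * M \<le> \<bar>s - s'\<bar>" unfolding M_def by simp
  moreover have "0 \<le> M" by (simp add: M_def)
  ultimately have "M \<le> \<bar>s - s'\<bar>" by linarith
  then show ?thesis using m(2)[OF y] by (simp add: M_def)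
qed

text \<open>For a fixed path the starting time enters through \<open>E\<close> alone.\<close>

lemma action_time_lipschitz:
  assumes "0 < d" "continuous_on {0..d} x" "continuous_on {0..d} x'"
  shows "\<bar>action d s x x' - action d s' x x'\<bar> \<le> C * \<bar>s - s'\<bar> * d"
proof -
  have "((\<lambda>y. ((x' y)\<^sup>2 / 2 - E (x y) (s + y)) - ((x' y)\<^sup>2 / 2 - E (x y) (s' + y))) has_integral
      (action d s x x' - action d s' x x')) {0..d}"
    unfolding action_def
    by (intro has_integral_diff integrable_integral action_integrable assms)
  then have "norm (action d s x x' - action d s' x x') \<le> C * \<bar>s - s'\<bar> * measure lborel {0..d}"
  proof (rule has_integral_bound_real[OF _ finite.emptyI, rotated])
    fix y
    show "norm (((x' y)\<^sup>2 / 2 - E (x y) (s + y)) - ((x' y)\<^sup>2 / 2 - E (x y) (s' + y))) \<le> C * \<bar>s - s'\<bar>"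
      using E_lipschitz_t[of "x y" "s + y" "s' + y"] by (simp add: abs_minus_commute)
  qed (use C_pos in auto)
  then show ?thesis using assms by simp
qed

section \<open>The second variation and conjugate points\<close>

definition jacobi :: "real \<Rightarrow> (real \<Rightarrow> real) \<Rightarrow> (real \<Rightarrow> real) \<Rightarrow> (real \<Rightarrow> real) \<Rightarrow> bool" where
  "jacobi s v \<xi> \<eta> \<longleftrightarrow> (\<forall>y. (\<xi> has_real_derivative \<eta> y) (at y)) \<and>
     (\<forall>y. (\<eta> has_real_derivative - (Euu (v y) (s + y) * \<xi> y)) (at y))"

text \<open>The case \<open>l = 0\<close> of the fixed point lemma. The clamped equation is the true
  one because \<open>Euu\<close> vanishes along the trajectory outside the window and at its
  ends.\<close>

lemma jacobi_exists:
  assumes "short d" and cr: "crossing d s v w"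
  obtains \<xi> \<eta> where "jacobi s v \<xi> \<eta>" "\<xi> 0 = a" "\<eta> 0 = b"
proof -
  have d: "0 < d" "8 * C * d\<^sup>2 \<le> 1" using assms(1) by (auto simp: short_def)
  define cl where "cl y = max 0 (min d y)" for y
  have "continuous_on UNIV (\<lambda>z :: real \<times> real. v (fst z))"
    by (rule continuous_on_compose2[OF crossing_continuous(1)[OF cr, of UNIV]
          continuous_on_fst[OF continuous_on_id]]) simp
  then have F: "continuous_on UNIV (\<lambda>z. Euu (v (fst z)) (s + fst z) * snd z)"
    by (intro continuous_on_mult cont_comp(4) continuous_intros)
  have lip: "\<bar>Euu (v y) (s + y) * p - Euu (v y) (s + y) * q\<bar> \<le> C * \<bar>p - q\<bar>" for y p q
    unfolding right_diff_distrib[symmetric] abs_mult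
    by (rule mult_right_mono[OF Euu_bound]) simp
  have small: "4 * C * d\<^sup>2 \<le> 1"
    using d mult_nonneg_nonneg[of C "d\<^sup>2"] C_pos by auto
  obtain \<xi> \<eta> k where \<xi>: "\<And>y. (\<xi> has_real_derivative \<eta> y) (at y)"
    and \<eta>: "\<And>y. (\<eta> has_real_derivative - (Euu (v (cl y)) (s + cl y) * \<xi> (cl y))) (at y)"
    and init: "\<xi> 0 = a" "\<eta> 0 = b + 0 * k"
    unfolding cl_def
    by (rule second_order_fixed_point[of "\<lambda>y p. Euu (v y) (s + y) * p" C d 0 a b, OF F lip d(1) small])
      auto
  have "Euu (v (cl y)) (s + cl y) * \<xi> (cl y) = Euu (v y) (s + y) * \<xi> y" for y
  proof (cases "y \<in> {0..d}")
    case False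
    then have "y \<le> 0 \<or> d \<le> y" "cl y \<le> 0 \<or> d \<le> cl y"
      using d by (auto simp: cl_def)
    then have "v y \<le> - U \<or> U \<le> v y" "v (cl y) \<le> - U \<or> U \<le> v (cl y)"
      using cr unfolding crossing_def by blast+
    then have "U \<le> \<bar>v y\<bar>" "U \<le> \<bar>v (cl y)\<bar>" by linarith+
    then show ?thesis by (simp add: Euu_outside)
  qed (simp add: cl_def)
  with \<xi> \<eta> have "jacobi s v \<xi> \<eta>"
    by (simp add: jacobi_def)
  with init show thesis using that[of \<xi> \<eta>] by simp
qed

text \<open>The quadratic form is the index form of the field \<open>\<zeta> - \<epsilon> w\<close>, which is constant outside
  the window. A Jacobi field vanishing far to the left is nearly constant when it enters the
  window, so its logarithmic derivative can only remain finite if the index form is almost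
  nonnegative.\<close>

lemma conjugate_if_negative:
  assumes "short d" and cr: "crossing d s v w"
    and z: "\<And>y. y \<in> {0..d} \<Longrightarrow> (\<zeta> has_real_derivative \<zeta>' y) (at y)"
    and z': "continuous_on {0..d} \<zeta>'" and z_ends: "\<zeta> 0 = 0" "\<zeta> d = 0"
    and neg: "integral {0..d} (\<lambda>y. (\<zeta>' y)\<^sup>2 - Euu (v y) (s + y) * (\<zeta> y)\<^sup>2
      - 2 * \<epsilon> * Eut (v y) (s + y) * \<zeta> y - \<epsilon>\<^sup>2 * Ett (v y) (s + y)) < 0" (is "integral _ ?b < 0")
  obtains \<xi> \<eta> t1 t2 where "jacobi s v \<xi> \<eta>" "t1 < t2" "\<xi> t1 = 0" "\<xi> t2 = 0" "\<exists>t. \<xi> t \<noteq> 0"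
proof -
  define B where "B = integral {0..d} ?b"
  have B: "B < 0" using neg by (simp add: B_def)
  have d: "0 < d" using assms(1) by (auto simp: short_def)
  have v: "(v has_real_derivative w y) (at y)" and w: "(w has_real_derivative - Eu (v y) (s + y)) (at y)"
    and v_ends: "v 0 = - U" "v d = U" and v_out: "y \<le> 0 \<Longrightarrow> v y \<le> - U" "d \<le> y \<Longrightarrow> U \<le> v y" for y
    using cr by (auto simp: crossing_def)
  have id: "((\<lambda>y. s + y) has_real_derivative 1) (at y)" for y
    by (auto intro!: derivative_eq_intros)
  note cont = crossing_continuous[OF cr] has_real_derivative_imp_continuous_on[OF z] z'
  \<comment> \<open>Chosen so that the boundary term \<open>(\<epsilon> * w 0)^2 / M\<close>, which
    appears on entering the window, is smaller than \<open>- B\<close>.\<close>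
  define M where "M = ((\<epsilon> * w 0)\<^sup>2 + 1) / (- B)"
  have M: "0 < M" unfolding M_def using B by (intro divide_pos_pos add_nonneg_pos) auto
  have MB: "(\<epsilon> * w 0)\<^sup>2 / M < - B"
  proof -
    have "- B * M = (\<epsilon> * w 0)\<^sup>2 + 1" using B by (simp add: M_def)
    then show ?thesis using M by (simp add: pos_divide_less_eq)
  qed
  obtain \<xi> \<eta> where j: "jacobi s v \<xi> \<eta>" and init: "\<xi> 0 = M" "\<eta> 0 = 1"
    using jacobi_exists[OF assms(1) cr] by blast
  then have x: "(\<xi> has_real_derivative \<eta> y) (at y)"
    and e: "(\<eta> has_real_derivative - (Euu (v y) (s + y) * \<xi> y)) (at y)" for y
    by (auto simp: jacobi_def)
  have e0: "(\<eta> has_real_derivative 0) (at y)" if "y \<le> 0 \<or> d \<le> y" for y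
    using e[of y] that v_out[of y] Euu_outside[of "v y" "s + y"] by fastforce
  \<comment> \<open>Up to time 0 the Jacobi field is affine with slope 1 and ends at
    \<open>M\<close>, so its first zero is \<open>- M\<close>.\<close>
  have left: "\<xi> (- M) = \<xi> 0 + \<eta> 0 * (- M - 0)"
    using M by (intro affine_if_second_deriv_zero(2)[of "{..0}"] x e0) auto
  have right: "\<xi> y = \<xi> d + \<eta> d * (y - d)" if "d \<le> y" for y
    using that by (intro affine_if_second_deriv_zero(2)[of "{d..}"] x e0) auto
  have "\<exists>t2>-M. \<xi> t2 = 0"
  proof (rule ccontr)
    assume "\<not> ?thesis"
    then have ne: "\<xi> y \<noteq> 0" if "- M < y" for y using that by blast
    have pos: "0 < \<xi> y" if y: "0 \<le> y" for y
    proof (rule ccontr)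
      assume "\<not> 0 < \<xi> y"
      then have "\<exists>c\<ge>0. c \<le> y \<and> \<xi> c = 0"
        using y init M by (intro IVT2' has_real_derivative_imp_continuous_on[OF x]) auto
      then obtain c where "0 \<le> c" "\<xi> c = 0" by blast
      then show False using ne[of c] M by simp
    qed
    \<comment> \<open>After the window the field is affine; a negative slope would bring it to
      zero.\<close>
    have "0 \<le> \<eta> d"
    proof (rule ccontr)
      assume *: "\<not> 0 \<le> \<eta> d"
      define y where "y = d - \<xi> d / \<eta> d"
      have "d \<le> y" using * pos[of d] d by (simp add: y_def divide_nonneg_neg divide_le_0_iff)
      then have "\<xi> y = 0" using right[of y] * by (simp add: y_def)
      then show False using ne[of y] \<open>d \<le> y\<close> d M by simp
    qed
    then have w_end: "0 \<le> \<eta> d / \<xi> d * (\<zeta> d - \<epsilon> * w d)\<^sup>2"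
      using pos[of d] d by simp
    \<comment> \<open>\<open>\<zeta> - \<epsilon> * w\<close> is, to first order, the displacement
      at fixed absolute time when the start moves by \<open>\<epsilon>\<close>. The form
      \<open>?q\<close> is the integrand of its index form.\<close>
    have int: "(\<lambda>y. (\<zeta>' y + \<epsilon> * Eu (v y) (s + y))\<^sup>2 - Euu (v y) (s + y) * (\<zeta> y - \<epsilon> * w y)\<^sup>2)
        integrable_on {0..d}" (is "?q integrable_on _")
      by (intro integrable_continuous_interval continuous_intros cont_comp cont) auto
    \<comment> \<open>\<open>\<eta> / \<xi>\<close> solves the Riccati equation of the trajectory.
      Its boundary term at \<open>d\<close> is nonnegative and its value at 0 is
      \<open>1 / M\<close>.\<close>
    have ge: "\<eta> d / \<xi> d * (\<zeta> d - \<epsilon> * w d)\<^sup>2 - \<eta> 0 / \<xi> 0 * (\<zeta> 0 - \<epsilon> * w 0)\<^sup>2 \<le> integral {0..d} ?q"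
    proof (rule riccati_index_form[where
          w' = "\<lambda>y. (- (Euu (v y) (s + y) * \<xi> y) * \<xi> y - \<eta> y * \<eta> y) / (\<xi> y * \<xi> y)"])
      fix y assume y: "y \<in> {0..d}"
      show "((\<lambda>y. \<zeta> y - \<epsilon> * w y) has_real_derivative \<zeta>' y + \<epsilon> * Eu (v y) (s + y)) (at y)"
        using y by (auto intro!: derivative_eq_intros z w)
      have "\<xi> y \<noteq> 0" using pos[of y] y by auto
      then show "((\<lambda>y. \<eta> y / \<xi> y) has_real_derivative
          (- (Euu (v y) (s + y) * \<xi> y) * \<xi> y - \<eta> y * \<eta> y) / (\<xi> y * \<xi> y)) (at y)"
        by (intro DERIV_divide x e)
      show "(- (Euu (v y) (s + y) * \<xi> y) * \<xi> y - \<eta> y * \<eta> y) / (\<xi> y * \<xi> y) + (\<eta> y / \<xi> y)\<^sup>2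
          + Euu (v y) (s + y) \<le> 0"
        using \<open>\<xi> y \<noteq> 0\<close> by (simp add: diff_divide_distrib power2_eq_square)
    qed (use d int in auto)
    \<comment> \<open>The two integrands differ by a total derivative of terms containing
      \<open>Eu\<close> or \<open>Et\<close>, which vanish at the ends \<open>- U\<close> and
      \<open>U\<close>.\<close>
    have "((\<lambda>y. ?q y - ?b y) has_integral
        (2 * \<epsilon> * \<zeta> d * Eu (v d) (s + d) + \<epsilon>\<^sup>2 * (Et (v d) (s + d) - w d * Eu (v d) (s + d))
         - (2 * \<epsilon> * \<zeta> 0 * Eu (v 0) (s + 0) + \<epsilon>\<^sup>2 * (Et (v 0) (s + 0) - w 0 * Eu (v 0) (s + 0))))) {0..d}"
    proof (rule integral_deriv_real[where f = "\<lambda>y. 2 * \<epsilon> * \<zeta> y * Eu (v y) (s + y)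
          + \<epsilon>\<^sup>2 * (Et (v y) (s + y) - w y * Eu (v y) (s + y))"])
      fix y assume y: "y \<in> {0..d}"
      show "((\<lambda>y. 2 * \<epsilon> * \<zeta> y * Eu (v y) (s + y)
          + \<epsilon>\<^sup>2 * (Et (v y) (s + y) - w y * Eu (v y) (s + y))) has_real_derivative ?q y - ?b y) (at y)"
        by (rule derivative_eq_intros z[OF y] w Eu_comp[OF v id] Et_comp[OF v id] refl)+
          (simp add: power2_eq_square algebra_simps)
    qed (use d in simp)
    then have "((\<lambda>y. ?q y - ?b y) has_integral 0) {0..d}"
      using U_pos by (simp add: v_ends Eu_outside Et_outside)
    moreover have "((\<lambda>y. ?q y - ?b y) has_integral (integral {0..d} ?q - B)) {0..d}"
      unfolding B_def
      by (rule has_integral_diff[OF integrable_integral[OF int] integrable_integral],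
          rule integrable_continuous_interval) (intro continuous_intros cont_comp cont)
    ultimately have "0 = integral {0..d} ?q - B"
      by (rule has_integral_unique)
    then have "integral {0..d} ?q = B" by simp
    with ge w_end MB init z_ends show False
      by (simp add: power_mult_distrib)
  qed
  then obtain t2 where "- M < t2" "\<xi> t2 = 0" by blast
  moreover have "\<exists>t. \<xi> t \<noteq> 0"
    using init M by (intro exI[of _ 0]) simp
  ultimately show thesis
    using that[of \<xi> \<eta> "- M" t2] j left init by simp
qed

text \<open>The finite difference of two crossings replaces the derivative of the crossing in
  \<open>s\<close>, whose existence is never asserted. A second order expansion of the action bounds
  it below by the quadratic form; the touching parabola bounds it above, and using both shifts
  \<open>e\<close> and \<open>- e\<close> eliminates the linear terms.\<close>

lemma negative_if_touching:
  assumes "short d" and cr: "\<And>s. crossing d s (v s) (w s)"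
    and c: "0 < c" "0 < r"
    and touch: "\<And>h. \<bar>h\<bar> \<le> r \<Longrightarrow>
      action d (s + h) (v (s + h)) (w (s + h)) \<le> action d s (v s) (w s) + b * h - c * h\<^sup>2"
  obtains \<epsilon> where "integral {0..d} (\<lambda>y. (w (s + \<epsilon>) y - w s y)\<^sup>2
      - Euu (v s y) (s + y) * (v (s + \<epsilon>) y - v s y)\<^sup>2
      - 2 * \<epsilon> * Eut (v s y) (s + y) * (v (s + \<epsilon>) y - v s y) - \<epsilon>\<^sup>2 * Ett (v s y) (s + y)) < 0"
proof -
  have d: "0 < d" using assms(1) by (auto simp: short_def)
  have dv: "(v p has_real_derivative w p y) (at y)"
    and dw: "(w p has_real_derivative - Eu (v p y) (p + y)) (at y)"
    and v_ends: "v p 0 = - U" "v p d = U" for y p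
    using cr[of p] by (auto simp: crossing_def)
  note cont = crossing_continuous[OF cr]
  \<comment> \<open>This makes the accumulated Taylor error \<open>2 * \<kappa> * e^2 * d\<close> a
    quarter of \<open>c * e^2\<close>.\<close>
  define \<kappa> where "\<kappa> = c / (8 * d)"
  have \<kappa>: "0 < \<kappa>" using c d by (simp add: \<kappa>_def)
  obtain K where K: "\<And>y. y \<in> {0..d} \<Longrightarrow> \<bar>v s y\<bar> \<le> K"
  proof -
    have "bounded (v s ` {0..d})"
      by (intro compact_imp_bounded compact_continuous_image cont) auto
    then obtain a where "\<forall>x\<in>{0..d}. \<bar>v s x\<bar> \<le> a" by (auto simp: bounded_iff)
    then show thesis using that[of a] by blast
  qed
  \<comment> \<open>The margins of 1 make room for the Taylor segments, as \<open>e\<close> will be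
    at most 1.\<close>
  define S where "S = {- K - 1..K + 1} \<times> {s - 1..s + d + 1}"
  have "compact S" unfolding S_def by (intro compact_Times) auto
  have uc: "\<exists>\<rho>>0. \<forall>x\<in>S. \<forall>x'\<in>S. dist x' x < \<rho> \<longrightarrow> \<bar>f (fst x') (snd x') - f (fst x) (snd x)\<bar> \<le> \<kappa>"
    if "continuous_on UNIV (\<lambda>z. f (fst z) (snd z))" for f :: "real \<Rightarrow> real \<Rightarrow> real"
  proof -
    have "uniformly_continuous_on S (\<lambda>z. f (fst z) (snd z))"
      using \<open>compact S\<close> that by (intro compact_uniformly_continuous) (auto intro: continuous_on_subset)
    then show ?thesis
      using \<kappa> unfolding uniformly_continuous_on_def dist_real_def by (meson less_imp_le)
  qed
  obtain \<rho>1 \<rho>2 \<rho>3 where \<rho>: "0 < \<rho>1" "0 < \<rho>2" "0 < \<rho>3"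
    and uc1: "\<forall>x\<in>S. \<forall>x'\<in>S. dist x' x < \<rho>1 \<longrightarrow> \<bar>Euu (fst x') (snd x') - Euu (fst x) (snd x)\<bar> \<le> \<kappa>"
    and uc2: "\<forall>x\<in>S. \<forall>x'\<in>S. dist x' x < \<rho>2 \<longrightarrow> \<bar>Eut (fst x') (snd x') - Eut (fst x) (snd x)\<bar> \<le> \<kappa>"
    and uc3: "\<forall>x\<in>S. \<forall>x'\<in>S. dist x' x < \<rho>3 \<longrightarrow> \<bar>Ett (fst x') (snd x') - Ett (fst x) (snd x)\<bar> \<le> \<kappa>"
    using uc[OF cont_Euu] uc[OF cont_Eut] uc[OF cont_Ett] by blast
  define e where "e = Min {1, r, \<rho>1 / 4, \<rho>2 / 4, \<rho>3 / 4}"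
  have e: "0 < e" "e \<le> 1" "e \<le> r" "4 * e \<le> \<rho>1" "4 * e \<le> \<rho>2" "4 * e \<le> \<rho>3"
    using \<rho> c by (auto simp: e_def)
  define b2 where "b2 \<epsilon> y = (w (s + \<epsilon>) y - w s y)\<^sup>2
      - Euu (v s y) (s + y) * (v (s + \<epsilon>) y - v s y)\<^sup>2
      - 2 * \<epsilon> * Eut (v s y) (s + y) * (v (s + \<epsilon>) y - v s y) - \<epsilon>\<^sup>2 * Ett (v s y) (s + y)" for \<epsilon> y
  \<comment> \<open>\<open>- D\<close> is the coefficient of the linear term in the shift.\<close>
  define D where "D = integral {0..d} (\<lambda>y. Et (v s y) (s + y))"
  have taylor: "E (a + h) (t + k) \<le> E a t + Eu a t * h + Et a t * k +
      (Euu a t * h\<^sup>2 + 2 * Eut a t * h * k + Ett a t * k\<^sup>2) / 2 + 2 * \<kappa> * e\<^sup>2"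
    if at: "(a, t) \<in> {- K..K} \<times> {s..s + d}" and hk: "\<bar>h\<bar> \<le> e" "\<bar>k\<bar> \<le> e" for a t h k
  proof -
    obtain \<theta> where \<theta>: "0 \<le> \<theta>" "\<theta> \<le> 1" and eq: "E (a + h) (t + k) = E a t + Eu a t * h + Et a t * k +
      (Euu (a + \<theta> * h) (t + \<theta> * k) * h\<^sup>2 + 2 * Eut (a + \<theta> * h) (t + \<theta> * k) * h * k +
       Ett (a + \<theta> * h) (t + \<theta> * k) * k\<^sup>2) / 2"
      by (rule E_taylor)
    define x x' where "x = (a, t)" and "x' = (a + \<theta> * h, t + \<theta> * k)"
    have th: "\<bar>\<theta> * h\<bar> \<le> e" "\<bar>\<theta> * k\<bar> \<le> e"
      using mult_mono[of "\<bar>\<theta>\<bar>" 1 "\<bar>h\<bar>" e] mult_mono[of "\<bar>\<theta>\<bar>" 1 "\<bar>k\<bar>" e] \<theta> hk e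
      by (auto simp: abs_mult)
    have "dist x' x \<le> \<bar>\<theta> * h\<bar> + \<bar>\<theta> * k\<bar>"
      unfolding x_def x'_def dist_norm
      using norm_Pair_le[of "\<theta> * h" "\<theta> * k"] by simp
    then have dist: "dist x' x < 4 * e" using th e by linarith
    have S: "x \<in> S" "x' \<in> S"
      using at th e by (auto simp: S_def x_def x'_def abs_le_iff)
    have h2: "h\<^sup>2 \<le> e\<^sup>2" "k\<^sup>2 \<le> e\<^sup>2" "\<bar>h * k\<bar> \<le> e\<^sup>2"
      using hk e power_mono[of "\<bar>h\<bar>" e 2] power_mono[of "\<bar>k\<bar>" e 2] mult_mono[of "\<bar>h\<bar>" e "\<bar>k\<bar>" e]
      by (simp_all add: abs_mult power2_eq_square[of e])
    have "\<bar>Euu (a + \<theta> * h) (t + \<theta> * k) - Euu a t\<bar> * \<bar>h\<^sup>2\<bar> \<le> \<kappa> * e\<^sup>2"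
      using uc1 S dist e h2 \<kappa> unfolding x_def x'_def by (intro mult_mono) fastforce+
    moreover have "\<bar>Eut (a + \<theta> * h) (t + \<theta> * k) - Eut a t\<bar> * \<bar>h * k\<bar> \<le> \<kappa> * e\<^sup>2"
      using uc2 S dist e h2 \<kappa> unfolding x_def x'_def by (intro mult_mono) fastforce+
    moreover have "\<bar>Ett (a + \<theta> * h) (t + \<theta> * k) - Ett a t\<bar> * \<bar>k\<^sup>2\<bar> \<le> \<kappa> * e\<^sup>2"
      using uc3 S dist e h2 \<kappa> unfolding x_def x'_def by (intro mult_mono) fastforce+
    ultimately have "Euu (a + \<theta> * h) (t + \<theta> * k) * h\<^sup>2 - Euu a t * h\<^sup>2 \<le> \<kappa> * e\<^sup>2"
      "Eut (a + \<theta> * h) (t + \<theta> * k) * (h * k) - Eut a t * (h * k) \<le> \<kappa> * e\<^sup>2"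
      "Ett (a + \<theta> * h) (t + \<theta> * k) * k\<^sup>2 - Ett a t * k\<^sup>2 \<le> \<kappa> * e\<^sup>2"
      unfolding abs_mult[symmetric] left_diff_distrib by (auto intro: order_trans[OF abs_ge_self])
    then show ?thesis
      unfolding eq by (simp add: field_simps)
  qed
  have lower: "action d s (v s) (w s) + integral {0..d} (b2 \<epsilon>) / 2 - \<epsilon> * D - 2 * \<kappa> * e\<^sup>2 * d
      \<le> action d (s + \<epsilon>) (v (s + \<epsilon>)) (w (s + \<epsilon>))" if \<epsilon>: "\<bar>\<epsilon>\<bar> \<le> e" for \<epsilon>
  proof -
    define \<zeta> where "\<zeta> y = v (s + \<epsilon>) y - v s y" for y
    \<comment> \<open>The first variation at \<open>v s\<close>, the derivative of
      \<open>w s * \<zeta>\<close>; its integral is zero.\<close>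
    have "((\<lambda>y. w s y * (w (s + \<epsilon>) y - w s y) - Eu (v s y) (s + y) * \<zeta> y) has_integral
        (w s d * \<zeta> d - w s 0 * \<zeta> 0)) {0..d}"
      unfolding \<zeta>_def
      using d by (intro integral_deriv_real) (auto intro!: derivative_eq_intros dv dw)
    then have i1: "((\<lambda>y. w s y * (w (s + \<epsilon>) y - w s y) - Eu (v s y) (s + y) * \<zeta> y) has_integral 0) {0..d}"
      by (simp add: v_ends \<zeta>_def)
    have i2: "((\<lambda>y. (w s y)\<^sup>2 / 2 - E (v s y) (s + y)) has_integral action d s (v s) (w s)) {0..d}"
      unfolding action_def by (intro integrable_integral action_integrable cont)
    have i3: "(b2 \<epsilon> has_integral integral {0..d} (b2 \<epsilon>)) {0..d}"
      unfolding b2_def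
      by (intro integrable_integral integrable_continuous_interval continuous_intros cont_comp cont)
    have i4: "((\<lambda>y. Et (v s y) (s + y)) has_integral D) {0..d}"
      unfolding D_def
      by (intro integrable_integral integrable_continuous_interval continuous_intros cont_comp cont)
    have i5: "((\<lambda>y. 2 * \<kappa> * e\<^sup>2) has_integral (2 * \<kappa> * e\<^sup>2 * d)) {0..d}"
      using has_integral_const_real[of "2 * \<kappa> * e\<^sup>2" 0 d] d by (simp add: mult_ac)
    have "((\<lambda>y. ((w s y)\<^sup>2 / 2 - E (v s y) (s + y)) + b2 \<epsilon> y / 2 - \<epsilon> * Et (v s y) (s + y)
          - 2 * \<kappa> * e\<^sup>2 + (w s y * (w (s + \<epsilon>) y - w s y) - Eu (v s y) (s + y) * \<zeta> y)) has_integral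
        (action d s (v s) (w s) + integral {0..d} (b2 \<epsilon>) / 2 - \<epsilon> * D - 2 * \<kappa> * e\<^sup>2 * d + 0)) {0..d}"
      by (intro has_integral_add has_integral_diff has_integral_divide has_integral_mult_right i1 i2 i3 i4 i5)
    moreover have "((\<lambda>y. (w (s + \<epsilon>) y)\<^sup>2 / 2 - E (v (s + \<epsilon>) y) (s + \<epsilon> + y)) has_integral
        action d (s + \<epsilon>) (v (s + \<epsilon>)) (w (s + \<epsilon>))) {0..d}"
      unfolding action_def by (intro integrable_integral action_integrable cont)
    ultimately have "action d s (v s) (w s) + integral {0..d} (b2 \<epsilon>) / 2 - \<epsilon> * D - 2 * \<kappa> * e\<^sup>2 * d + 0
      \<le> action d (s + \<epsilon>) (v (s + \<epsilon>)) (w (s + \<epsilon>))"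
    proof (rule has_integral_le)
      fix y assume y: "y \<in> {0..d}"
      have "\<bar>\<zeta> y\<bar> \<le> e"
        using crossing_lipschitz[OF assms(1) cr cr y, of "s + \<epsilon>" s] \<epsilon> by (simp add: \<zeta>_def)
      then have t: "E (v s y + \<zeta> y) (s + y + \<epsilon>) \<le> E (v s y) (s + y) + Eu (v s y) (s + y) * \<zeta> y
          + Et (v s y) (s + y) * \<epsilon> + (Euu (v s y) (s + y) * (\<zeta> y)\<^sup>2
          + 2 * Eut (v s y) (s + y) * \<zeta> y * \<epsilon> + Ett (v s y) (s + y) * \<epsilon>\<^sup>2) / 2 + 2 * \<kappa> * e\<^sup>2"
        using y K[OF y] \<epsilon> by (intro taylor) (auto simp: abs_le_iff)
      have eqs: "v s y + \<zeta> y = v (s + \<epsilon>) y" "s + y + \<epsilon> = s + \<epsilon> + y"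
        by (auto simp: \<zeta>_def)
      have b2: "b2 \<epsilon> y = (w (s + \<epsilon>) y - w s y)\<^sup>2 - (Euu (v s y) (s + y) * (\<zeta> y)\<^sup>2
          + 2 * Eut (v s y) (s + y) * \<zeta> y * \<epsilon> + Ett (v s y) (s + y) * \<epsilon>\<^sup>2)"
        by (simp add: b2_def \<zeta>_def algebra_simps)
      have sq: "(w s y)\<^sup>2 / 2 + (w (s + \<epsilon>) y - w s y)\<^sup>2 / 2 + w s y * (w (s + \<epsilon>) y - w s y)
          = (w (s + \<epsilon>) y)\<^sup>2 / 2"
        by (simp add: power2_eq_square field_simps)
      have arith: "a - E0 + B / 2 - et - k + (m - eu) \<le> n - E1"
        if "E1 \<le> E0 + eu + et + Q / 2 + k" "B = W - Q" "a + W / 2 + m = n"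
        for a E0 B et k m eu n E1 Q W :: real
        using that by (simp add: field_simps)
      show "((w s y)\<^sup>2 / 2 - E (v s y) (s + y)) + b2 \<epsilon> y / 2 - \<epsilon> * Et (v s y) (s + y)
          - 2 * \<kappa> * e\<^sup>2 + (w s y * (w (s + \<epsilon>) y - w s y) - Eu (v s y) (s + y) * \<zeta> y)
        \<le> (w (s + \<epsilon>) y)\<^sup>2 / 2 - E (v (s + \<epsilon>) y) (s + \<epsilon> + y)"
        using arith[OF t b2 sq] unfolding eqs mult.commute[of \<epsilon>] .
    qed
    then show ?thesis by simp
  qed
  define X where "X = c * e\<^sup>2"
  have X: "0 < X" using c e by (simp add: X_def)
  have \<kappa>X: "2 * \<kappa> * e\<^sup>2 * d = X / 4" using d by (simp add: \<kappa>_def X_def)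
  have "action d s (v s) (w s) + integral {0..d} (b2 e) / 2 - e * D - X / 4
      \<le> action d s (v s) (w s) + b * e - X"
    using order_trans[OF lower[of e] touch[of e]] e unfolding \<kappa>X X_def by simp
  moreover have "action d s (v s) (w s) + integral {0..d} (b2 (- e)) / 2 + e * D - X / 4
      \<le> action d s (v s) (w s) - b * e - X"
    using order_trans[OF lower[of "- e"] touch[of "- e"]] e unfolding \<kappa>X X_def by simp
  \<comment> \<open>Adding both bounds cancels \<open>b\<close> and \<open>D\<close>: the two forms
    have sum at most \<open>- 3 * X\<close>.\<close>
  ultimately have "integral {0..d} (b2 e) < 0 \<or> integral {0..d} (b2 (- e)) < 0"
    using X by argo
  then show thesis using that unfolding b2_def by blast
qed

section \<open>Rigidity\<close>

abbreviation line :: "real \<Rightarrow> real \<Rightarrow> real" where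
  "line d y \<equiv> - U + 2 * U / d * y"

text \<open>Parametrised by the crossed fraction of the strip instead of time, so that
  \<open>d = 0\<close> makes sense and gives the mean of \<open>E\<close> over the time slice
  \<open>s\<close>.\<close>

definition line_mean :: "real \<Rightarrow> real \<Rightarrow> real" where
  "line_mean d s = integral {0..1} (\<lambda>x. E (- U + 2 * U * x) (s + d * x))"

lemma line_integral:
  assumes "0 < d"
  shows "integral {0..d} (\<lambda>y. E (line d y) (s + y)) = d * line_mean d s"
proof -
  have "continuous_on {0..d} (\<lambda>y. E (line d y) (s + y))"
    using assms by (intro continuous_intros cont_comp) auto
  then have "((\<lambda>y. E (line d y) (s + y)) has_integral integral {0..d} (\<lambda>y. E (line d y) (s + y))) (cbox 0 d)"
    by (auto intro!: integrable_integral integrable_continuous_interval)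
  from has_integral_affinity'[OF this assms, of 0]
  have "((\<lambda>x. E (line d (d * x)) (s + d * x)) has_integral
      (integral {0..d} (\<lambda>y. E (line d y) (s + y)) / d)) {0..1}"
    using assms by (simp add: divide_inverse mult.commute)
  moreover have "line d (d * x) = - U + 2 * U * x" for x
    using assms by simp
  ultimately have "line_mean d s = integral {0..d} (\<lambda>y. E (line d y) (s + y)) / d"
    unfolding line_mean_def by (auto intro: integral_unique)
  then show ?thesis using assms by simp
qed

lemma action_line:
  assumes "0 < d"
  shows "action d s (line d) (\<lambda>_. 2 * U / d) = 2 * U\<^sup>2 / d - d * line_mean d s"
proof -
  have "(\<lambda>y. E (line d y) (s + y)) integrable_on {0..d}"
    using assms by (intro integrable_continuous_interval continuous_intros cont_comp) auto
  then have "action d s (line d) (\<lambda>_. 2 * U / d)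
      = integral {0..d} (\<lambda>y. (2 * U / d)\<^sup>2 / 2) - d * line_mean d s"
    unfolding action_def line_integral[OF assms, symmetric]
    by (intro Henstock_Kurzweil_Integration.integral_diff) auto
  then show ?thesis using assms by (simp add: power2_eq_square)
qed

text \<open>Uniform motion has the least kinetic action between fixed ends: integrate
  \<open>(w - c)^2 \<ge> 0\<close> with \<open>c\<close> the mean velocity.\<close>

lemma action_ge:
  assumes d: "0 < d" and cr: "crossing d s v w"
  shows "2 * U\<^sup>2 / d - integral {0..d} (\<lambda>y. E (v y) (s + y)) \<le> action d s v w"
proof -
  define c where "c = 2 * U / d"
  note cont = crossing_continuous[OF cr]
  have "((\<lambda>y. c * w y) has_integral (c * v d - c * v 0)) {0..d}"
    using cr d by (intro integral_deriv_real) (auto simp: crossing_def intro!: derivative_eq_intros)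
  moreover have "((\<lambda>y. E (v y) (s + y)) has_integral integral {0..d} (\<lambda>y. E (v y) (s + y))) {0..d}"
    by (intro integrable_integral integrable_continuous_interval continuous_intros cont_comp cont)
  moreover have "((\<lambda>y. c\<^sup>2 / 2) has_integral (c\<^sup>2 / 2 * d)) {0..d}"
    using has_integral_const_real[of "c\<^sup>2 / 2" 0 d] d by (simp add: mult.commute)
  ultimately have "((\<lambda>y. c * w y - c\<^sup>2 / 2 - E (v y) (s + y)) has_integral
      (c * v d - c * v 0 - c\<^sup>2 / 2 * d - integral {0..d} (\<lambda>y. E (v y) (s + y)))) {0..d}"
    by (intro has_integral_diff)
  moreover have "((\<lambda>y. (w y)\<^sup>2 / 2 - E (v y) (s + y)) has_integral action d s v w) {0..d}"
    unfolding action_def by (intro integrable_integral action_integrable cont)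
  ultimately have "c * v d - c * v 0 - c\<^sup>2 / 2 * d - integral {0..d} (\<lambda>y. E (v y) (s + y)) \<le> action d s v w"
  proof (rule has_integral_le)
    fix y
    have "0 \<le> (w y - c)\<^sup>2" by simp
    then show "c * w y - c\<^sup>2 / 2 - E (v y) (s + y) \<le> (w y)\<^sup>2 / 2 - E (v y) (s + y)"
      by (simp add: power2_eq_square field_simps)
  qed
  moreover have "c * v d - c * v 0 - c\<^sup>2 / 2 * d = 2 * U\<^sup>2 / d"
    using cr d by (simp add: crossing_def c_def power2_eq_square)
  ultimately show ?thesis by simp
qed

lemma line_derivative:
  assumes "0 < d"
  shows "(line d has_real_derivative 2 * U / d) (at y)"
  using assms by (auto intro!: derivative_eq_intros)

text \<open>Only crossing trajectories are tested, and the field is a function of elapsed time; the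
  translation to absolute time is made in the final theorem.\<close>

definition no_conjugate :: bool where
  "no_conjugate \<longleftrightarrow> (\<forall>d s v w \<xi> \<eta> t1 t2. crossing d s v w \<longrightarrow> jacobi s v \<xi> \<eta> \<longrightarrow> t1 < t2 \<longrightarrow>
     \<xi> t1 = 0 \<longrightarrow> \<xi> t2 = 0 \<longrightarrow> (\<forall>t. \<xi> t = 0))"

lemma abs_integral_E_le:
  assumes "0 < d" "continuous_on {0..d} x"
  shows "\<bar>integral {0..d} (\<lambda>y. E (x y) (s + y))\<bar> \<le> C * d"
proof -
  have "continuous_on {0..d} (\<lambda>y. E (x y) (s + y))"
    by (intro cont_comp continuous_intros assms)
  from integral_bound[OF _ this, of C] show ?thesis using assms E_bound by simp
qed

text \<open>The minimal action is bounded and Lipschitz in \<open>s\<close>. If it were not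
  constant, a touching parabola would make the second variation negative and produce conjugate
  points. Its value is read off at a start after \<open>T\<close>.\<close>

lemma action_constant:
  assumes "no_conjugate" "short d" and cr: "\<And>s. crossing d s (v s) (w s)"
  shows "action d s (v s) (w s) = 2 * U\<^sup>2 / d"
proof -
  have d: "0 < d" using assms(2) by (auto simp: short_def)
  define f where "f s = action d s (v s) (w s)" for s
  note cont = crossing_continuous[OF cr]
  have min: "f s \<le> action d s (v s') (w s')" for s s'
    unfolding f_def using cr[of s'] cont
    by (intro action_minimal(1)[OF assms(2) cr]) (auto simp: crossing_def)
  have minl: "f s \<le> 2 * U\<^sup>2 / d - d * line_mean d s" for s
    unfolding f_def action_line[OF d, symmetric] using d
    by (intro action_minimal(1)[OF assms(2) cr] line_derivative) auto
  \<comment> \<open>The crossing that starts at \<open>s'\<close> serves as a competitor at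
    \<open>s\<close>.\<close>
  have lip: "f s - f s' \<le> C * d * \<bar>s - s'\<bar>" for s s'
    using min[of s s'] action_time_lipschitz[OF d cont(1,2), of s s' s' s'] unfolding f_def
    by (simp add: mult_ac)
  have contf: "continuous_on UNIV f"
  proof (rule lipschitz_on_continuous_on)
    show "(C * d)-lipschitz_on UNIV f"
    proof (rule lipschitz_onI)
      show "dist (f s) (f s') \<le> C * d * dist s s'" for s s'
        using lip[of s s'] lip[of s' s] by (auto simp: dist_real_def abs_le_iff abs_minus_commute)
    qed (use C_pos d in simp)
  qed
  have bound: "\<bar>f s\<bar> \<le> 2 * U\<^sup>2 / d + C * d" for s
  proof -
    have "\<bar>d * line_mean d s\<bar> \<le> C * d"
      unfolding line_integral[OF d, symmetric] using d
      by (intro abs_integral_E_le continuous_intros) auto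
    moreover have "2 * U\<^sup>2 / d - integral {0..d} (\<lambda>y. E (v s y) (s + y)) \<le> f s"
      unfolding f_def by (rule action_ge[OF d cr])
    moreover have "\<bar>integral {0..d} (\<lambda>y. E (v s y) (s + y))\<bar> \<le> C * d"
      by (rule abs_integral_E_le[OF d cont(1)])
    moreover have "0 \<le> 2 * U\<^sup>2 / d" using d by simp
    ultimately show ?thesis using minl[of s] by linarith
  qed
  have const: "f s = f s'" for s s'
  proof (rule ccontr)
    assume "f s \<noteq> f s'"
    then obtain s0 b c r where t: "0 < c" "0 < r"
        "\<And>h. \<bar>h\<bar> \<le> r \<Longrightarrow> f (s0 + h) \<le> f s0 + b * h - c * h\<^sup>2"
      using bounded_nonconstant_touching_parabola[OF contf bound] by metis
    obtain \<epsilon> where neg: "integral {0..d} (\<lambda>y. (w (s0 + \<epsilon>) y - w s0 y)\<^sup>2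
        - Euu (v s0 y) (s0 + y) * (v (s0 + \<epsilon>) y - v s0 y)\<^sup>2
        - 2 * \<epsilon> * Eut (v s0 y) (s0 + y) * (v (s0 + \<epsilon>) y - v s0 y) - \<epsilon>\<^sup>2 * Ett (v s0 y) (s0 + y)) < 0"
      using negative_if_touching[OF assms(2) cr t(1,2) t(3)[unfolded f_def]] by blast
    have z: "((\<lambda>y. v (s0 + \<epsilon>) y - v s0 y) has_real_derivative w (s0 + \<epsilon>) y - w s0 y) (at y)" for y
      using cr[of s0] cr[of "s0 + \<epsilon>"] by (auto simp: crossing_def intro!: derivative_eq_intros)
    have "\<exists>\<xi> \<eta> t1 t2. jacobi s0 (v s0) \<xi> \<eta> \<and> t1 < t2 \<and> \<xi> t1 = 0 \<and> \<xi> t2 = 0 \<and> (\<exists>t. \<xi> t \<noteq> 0)"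
      by (rule conjugate_if_negative[OF assms(2) cr z _ _ _ neg])
        (use cr[of s0] cr[of "s0 + \<epsilon>"] in \<open>auto simp: crossing_def intro!: continuous_intros cont\<close>)
    then show False
      using assms(1) cr[of s0] unfolding no_conjugate_def by blast
  qed
  \<comment> \<open>The potential vanishes on this window, so the upper bound from the line and the
    lower bound from \<open>action_ge\<close> coincide.\<close>
  have "f (T + 1) = 2 * U\<^sup>2 / d"
  proof -
    have zero: "integral {0..d} (\<lambda>y. E (x y) (T + 1 + y)) = 0" for x
    proof -
      have "integral {0..d} (\<lambda>y. E (x y) (T + 1 + y)) = integral {0..d} (\<lambda>y. 0)"
        by (intro integral_cong) (simp add: supp_t)
      then show ?thesis by simp
    qed
    show ?thesis
      using minl[of "T + 1"] action_ge[OF d cr, of "T + 1"]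
      unfolding f_def line_integral[OF d, symmetric] by (simp add: zero)
  qed
  then show ?thesis using const[of s "T + 1"] by (simp add: f_def)
qed

text \<open>All three follow from comparing the line with the crossing, whose action is the free
  one. Minimality gives the sign. By \<open>action_ge\<close> the integral of \<open>E\<close> along
  the crossing is nonnegative, and the line is close to the crossing. If the mean is zero, the line
  is a minimiser too, hence equals the crossing and has no acceleration.\<close>

lemma line_mean_bounds:
  assumes "no_conjugate" "short d"
  shows "line_mean d s \<le> 0" "- (C * d)\<^sup>2 \<le> line_mean d s"
    and "line_mean d s = 0 \<Longrightarrow> 0 < y \<Longrightarrow> y < d \<Longrightarrow> Eu (line d y) (s + y) = 0"
proof -
  have d: "0 < d" using assms(2) by (auto simp: short_def)
  obtain v w where cr: "\<And>s. crossing d s (v s) (w s)"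
  proof -
    have "\<forall>s. \<exists>v w. crossing d s v w" using crossing_exists[OF assms(2)] by metis
    then show thesis using that by metis
  qed
  note const = action_constant[OF assms cr]
  have v: "\<And>y. (v s has_real_derivative w s y) (at y)" "\<And>y. (w s has_real_derivative - Eu (v s y) (s + y)) (at y)"
    and v_ends: "v s 0 = - U" "v s d = U"
    using cr[of s] by (auto simp: crossing_def)
  have ends: "line d 0 = - U" "line d d = U" using d by auto
  have "action d s (v s) (w s) \<le> action d s (line d) (\<lambda>_. 2 * U / d)"
    using d by (intro action_minimal(1)[OF assms(2) cr line_derivative]) auto
  then show "line_mean d s \<le> 0"
    using d unfolding const action_line[OF d] by (simp add: mult_le_0_iff)
  \<comment> \<open>Distance \<open>C * d^2\<close> between the paths, Lipschitz constant
    \<open>C\<close> in \<open>u\<close>, duration \<open>d\<close>.\<close>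
  have "\<bar>integral {0..d} (\<lambda>y. E (v s y) (s + y) - E (line d y) (s + y))\<bar> \<le> C * (C * d\<^sup>2) * (d - 0)"
  proof (subst real_norm_def[symmetric], rule integral_bound)
    show "continuous_on {0..d} (\<lambda>y. E (v s y) (s + y) - E (line d y) (s + y))"
      using d by (intro continuous_intros cont_comp crossing_continuous[OF cr]) auto
    show "norm (E (v s y) (s + y) - E (line d y) (s + y)) \<le> C * (C * d\<^sup>2)" if "y \<in> {0..d}" for y
      unfolding real_norm_def
      by (rule order_trans[OF E_lipschitz_u mult_left_mono])
        (use crossing_near_line(2)[OF d v(1) v(2) v_ends that] C_pos in auto)
  qed (use d in simp)
  moreover have "integral {0..d} (\<lambda>y. E (v s y) (s + y) - E (line d y) (s + y))
      = integral {0..d} (\<lambda>y. E (v s y) (s + y)) - d * line_mean d s"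
    unfolding line_integral[OF d, symmetric] using d
    by (intro Henstock_Kurzweil_Integration.integral_diff integrable_continuous_interval
        continuous_intros cont_comp crossing_continuous[OF cr]) auto
  moreover have "0 \<le> integral {0..d} (\<lambda>y. E (v s y) (s + y))"
    using action_ge[OF d cr, of s] const[of s] by simp
  ultimately have "d * (- (C * d)\<^sup>2) \<le> d * line_mean d s"
    by (simp add: power2_eq_square mult_ac)
  then show "- (C * d)\<^sup>2 \<le> line_mean d s"
    by (rule mult_left_le_imp_le[OF _ d])
  assume 0: "line_mean d s = 0" and y: "0 < y" "y < d"
  have act: "action d s (line d) (\<lambda>_. 2 * U / d) = action d s (v s) (w s)"
    unfolding const action_line[OF d] 0 by simp
  have eq: "v s y = line d y" if "y \<in> {0..d}" for y
    by (rule action_minimal(2)[OF assms(2) cr line_derivative[OF d] _ ends act that, symmetric])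
      simp
  have w: "w s y = 2 * U / d" if "y \<in> {0<..<d}" for y
  proof -
    have "(v s has_real_derivative 2 * U / d) (at y)"
      by (rule has_field_derivative_transform_within_open[OF line_derivative[OF d], of "{0<..<d}"])
        (use that eq in auto)
    then show ?thesis using v(1) by (rule DERIV_unique[rotated])
  qed
  have "(w s has_real_derivative 0) (at y)"
    by (rule has_field_derivative_transform_within_open[OF DERIV_const, of "{0<..<d}"])
      (use y w in auto)
  then have "- Eu (v s y) (s + y) = 0" using v(2) by (rule DERIV_unique[rotated])
  then show "Eu (line d y) (s + y) = 0" using eq[of y] y by simp
qed

lemma short_mono: "short d \<Longrightarrow> 0 < d' \<Longrightarrow> d' \<le> d \<Longrightarrow> short d'"
proof -
  assume d: "short d" "0 < d'" "d' \<le> d"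
  then have "C * d'\<^sup>2 \<le> C * d\<^sup>2"
    using C_pos by (intro mult_left_mono power_mono) auto
  then show "short d'" using d by (auto simp: short_def)
qed

lemma short_exists:
  obtains d where "short d" "d \<le> 1"
proof
  define m where "m = min 1 (min (1 / (8 * C)) (U / (2 * C)))"
  have m: "0 < m" "m \<le> 1" "8 * C * m \<le> 1" "C * m < U"
    using C_pos U_pos by (auto simp: m_def min_def field_simps)
  then have "m\<^sup>2 \<le> m * 1" unfolding power2_eq_square by (intro mult_left_mono) auto
  then have "C * m\<^sup>2 \<le> C * m" using C_pos by simp
  then show "short m" using m by (auto simp: short_def)
  show "m \<le> 1" by fact
qed

section \<open>From time slices to all straight crossings\<close>

lemma line_mean_lipschitz: "\<bar>line_mean d s - line_mean 0 s\<bar> \<le> C * \<bar>d\<bar>"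
proof -
  have "line_mean d s - line_mean 0 s =
      integral {0..1} (\<lambda>x. E (- U + 2 * U * x) (s + d * x) - E (- U + 2 * U * x) (s + 0 * x))"
    unfolding line_mean_def
    by (intro Henstock_Kurzweil_Integration.integral_diff[symmetric] integrable_continuous_interval
        continuous_intros cont_comp)
  also have "norm \<dots> \<le> C * \<bar>d\<bar> * (1 - 0)"
  proof (rule integral_bound)
    fix x :: real assume x: "x \<in> {0..1}"
    have "\<bar>d * x\<bar> \<le> \<bar>d\<bar>" using x by (simp add: abs_mult mult_left_le)
    then have "C * \<bar>(s + d * x) - (s + 0 * x)\<bar> \<le> C * \<bar>d\<bar>" using C_pos by simp
    then show "norm (E (- U + 2 * U * x) (s + d * x) - E (- U + 2 * U * x) (s + 0 * x)) \<le> C * \<bar>d\<bar>"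
      using E_lipschitz_t[of "- U + 2 * U * x" "s + d * x" "s + 0 * x"] by simp
  qed (auto intro!: continuous_intros cont_comp)
  finally show ?thesis by simp
qed

text \<open>The mean along a line is of order \<open>d^2\<close> and differs from the slice mean by
  at most \<open>C * d\<close>; let \<open>d\<close> become small.\<close>

lemma line_mean_0:
  assumes "no_conjugate"
  shows "line_mean 0 s = 0"
proof (rule ccontr)
  assume "line_mean 0 s \<noteq> 0"
  define k where "k = \<bar>line_mean 0 s\<bar>"
  have k: "0 < k" using \<open>line_mean 0 s \<noteq> 0\<close> by (simp add: k_def)
  obtain d0 where d0: "short d0" using short_exists by blast
  \<comment> \<open>The bound \<open>1 / C\<close> lets \<open>(C * d)^2\<close> be replaced by
    \<open>C * d\<close>; the bound \<open>k / (4 * C)\<close> contradicts the resulting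
    \<open>k \<le> 2 * (C * d)\<close>.\<close>
  define d where "d = min d0 (min (1 / C) (k / (4 * C)))"
  have d: "0 < d" "d \<le> d0" "C * d \<le> 1" "4 * (C * d) \<le> k"
    using d0 C_pos k by (auto simp: d_def short_def min_def field_simps)
  have sh: "short d" using short_mono[OF d0 d(1,2)] .
  have Cd: "0 < C * d" using C_pos d by simp
  have "(C * d)\<^sup>2 \<le> C * d * 1"
    unfolding power2_eq_square using Cd d by (intro mult_left_mono) auto
  then have "\<bar>line_mean d s\<bar> \<le> C * d"
    using line_mean_bounds(1,2)[OF assms sh, of s] by auto
  moreover have "\<bar>line_mean d s - line_mean 0 s\<bar> \<le> C * d"
    using line_mean_lipschitz[of d s] d by simp
  ultimately have "k \<le> 2 * (C * d)" unfolding k_def by linarith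
  then show False using d Cd by linarith
qed

lemma continuous_line_mean: "continuous_on S (line_mean d)"
proof -
  have "continuous_on (S \<times> cbox 0 1) (\<lambda>(s, x). E (- U + 2 * U * x) (s + d * x))"
    unfolding case_prod_unfold by (intro continuous_intros cont_comp)
  from integral_continuous_on_param[OF this] show ?thesis
    unfolding line_mean_def by simp
qed

text \<open>By Fubini the time integral may be done first, for fixed position. There a line differs
  from a slice by the time shift \<open>d * x\<close> only, so the integral changes just through the
  ends of the interval, and the slices contribute zero.\<close>

lemma line_mean_integral_ge:
  assumes "no_conjugate" "0 < d" "- N \<le> T'" "T < T'"
  shows "- (C * exp (d - N) * d) \<le> integral {- N..T'} (line_mean d)"
proof -
  have swap: "integral {- N..T'} (line_mean \<delta>) =
      integral {0..1} (\<lambda>x. integral {- N..T'} (\<lambda>s. E (- U + 2 * U * x) (s + \<delta> * x)))" for \<delta>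
  proof -
    have "continuous_on (cbox (- N, 0) (T', 1)) (\<lambda>(s, x). E (- U + 2 * U * x) (s + \<delta> * x))"
      unfolding case_prod_unfold by (intro continuous_intros cont_comp)
    from integral_swap_continuous[OF this] show ?thesis
      unfolding line_mean_def by simp
  qed
  have int: "E u integrable_on {a..b}" for u a b
    by (intro integrable_continuous_interval cont_comp continuous_intros)
  have inner: "integral {- N..T'} (\<lambda>s. E u s) - C * exp (d - N) * d
      \<le> integral {- N..T'} (\<lambda>s. E u (s + d * x))" if x: "x \<in> {0..1}" for u x
  proof -
    have dx: "0 \<le> d * x" "d * x \<le> d" using x assms by (auto simp: mult_left_le)
    \<comment> \<open>The piece gained on the right lies beyond \<open>T\<close> and is zero; the
      piece lost on the left is controlled by the exponential decay.\<close>
    have "integral {- N..T'} (\<lambda>s. E u (s + d * x)) = integral {- N + d * x..T' + d * x} (E u)"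
      using integral_shift[of "- N" "d * x" T' "E u"]
      by (simp add: o_def cont_comp)
    moreover have "integral {- N..- N + d * x} (E u) + integral {- N + d * x..T' + d * x} (E u)
        = integral {- N..T' + d * x} (E u)"
      using dx assms by (intro Henstock_Kurzweil_Integration.integral_combine int) auto
    moreover have "integral {- N..T'} (E u) + integral {T'..T' + d * x} (E u)
        = integral {- N..T' + d * x} (E u)"
      using dx assms by (intro Henstock_Kurzweil_Integration.integral_combine int) auto
    moreover have "integral {T'..T' + d * x} (E u) = integral {T'..T' + d * x} (\<lambda>_. 0)"
      using assms by (intro integral_cong) (simp add: supp_t)
    moreover have "norm (integral {- N..- N + d * x} (E u)) \<le> C * exp (d - N) * (- N + d * x - (- N))"
    proof (rule integral_bound)
      fix t assume "t \<in> {- N..- N + d * x}"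
      then have "C * exp t \<le> C * exp (d - N)" using dx C_pos by auto
      then show "norm (E u t) \<le> C * exp (d - N)" using E_decay[of u t] by simp
    qed (use dx in \<open>auto intro!: cont_comp continuous_intros\<close>)
    moreover have "C * exp (d - N) * (- N + d * x - (- N)) \<le> C * exp (d - N) * d"
      using dx C_pos by (intro mult_left_mono) auto
    ultimately show ?thesis by (simp add: abs_le_iff)
  qed
  have outer: "(\<lambda>x. integral {- N..T'} (\<lambda>s. E (- U + 2 * U * x) (s + \<delta> * x))) integrable_on {0..1}" for \<delta>
  proof -
    have "continuous_on ({0..1} \<times> cbox (- N) T') (\<lambda>(x, s). E (- U + 2 * U * x) (s + \<delta> * x))"
      unfolding case_prod_unfold by (intro continuous_intros cont_comp)
    from integral_continuous_on_param[OF this] show ?thesis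
      by (simp add: integrable_continuous_interval)
  qed
  have "integral {0..1} (\<lambda>x. integral {- N..T'} (\<lambda>s. E (- U + 2 * U * x) (s + 0 * x)) - C * exp (d - N) * d)
      \<le> integral {0..1} (\<lambda>x. integral {- N..T'} (\<lambda>s. E (- U + 2 * U * x) (s + d * x)))"
    by (intro integral_le integrable_diff outer) (use inner in auto)
  also have "integral {0..1} (\<lambda>x. integral {- N..T'} (\<lambda>s. E (- U + 2 * U * x) (s + 0 * x)) - C * exp (d - N) * d)
     = integral {- N..T'} (line_mean 0) - C * exp (d - N) * d"
    unfolding swap by (subst Henstock_Kurzweil_Integration.integral_diff[OF outer]) auto
  also have "line_mean 0 = (\<lambda>_. 0)"
    using line_mean_0[OF assms(1)] by auto
  finally show ?thesis unfolding swap by simp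
qed

text \<open>\<open>- line_mean d\<close> is continuous and nonnegative, and its integral over ever
  longer intervals into the past tends to zero.\<close>

lemma line_mean_eq_0:
  assumes "no_conjugate" "short d"
  shows "line_mean d s = 0"
proof -
  have d: "0 < d" using assms(2) by (auto simp: short_def)
  \<comment> \<open>Beyond \<open>T\<close> for the integral estimate, and beyond \<open>s\<close>
    so that the interval has positive length.\<close>
  define T' where "T' = max T s + 1"
  have T': "T < T'" "s < T'" by (auto simp: T'_def)
  define I where "I = integral {s..T'} (\<lambda>s. - line_mean d s)"
  have cont: "continuous_on S (\<lambda>s. - line_mean d s)" for S
    by (intro continuous_intros continuous_line_mean)
  have nonneg: "0 \<le> - line_mean d s" for s
    using line_mean_bounds(1)[OF assms] by simp
  have le: "I \<le> C * exp d * d * exp (- N)" if "- s \<le> N" for N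
  proof -
    have "I \<le> integral {- N..T'} (\<lambda>s. - line_mean d s)"
      unfolding I_def using that nonneg
      by (intro integral_subset_le integrable_continuous_interval cont) auto
    also have "\<dots> \<le> C * exp (d - N) * d"
      using line_mean_integral_ge[OF assms(1) d, of N T'] that T' by simp
    finally show ?thesis by (simp add: exp_diff exp_minus field_simps)
  qed
  have "((\<lambda>N. C * exp d * d * exp (- N)) \<longlongrightarrow> C * exp d * d * 0) at_top"
    by (intro tendsto_intros filterlim_compose[OF exp_at_bot] filterlim_uminus_at_bot_at_top)
  moreover have "eventually (\<lambda>N. I \<le> C * exp d * d * exp (- N)) at_top"
    using eventually_ge_at_top[of "- s"] by eventually_elim (rule le)
  ultimately have "I \<le> C * exp d * d * 0"
    by (intro tendsto_lowerbound[OF _ _ trivial_limit_at_top_linorder])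
  moreover have "0 \<le> I"
    unfolding I_def by (intro integral_nonneg integrable_continuous_interval cont nonneg)
  ultimately have "I = 0" by simp
  then have "\<forall>s\<in>{s..T'}. - line_mean d s = 0"
    unfolding I_def using integral_eq_0_iff[OF cont T'(2) nonneg] by blast
  then show ?thesis using T' by auto
qed

theorem potential_eq_0:
  assumes "no_conjugate"
  shows "E u t = 0"
proof -
  obtain d where sh: "short d" using short_exists by blast
  then have d: "0 < d" by (auto simp: short_def)
  have "Eu u t = 0" for u
  proof (cases "U \<le> \<bar>u\<bar>")
    case False
    \<comment> \<open>The elapsed time at which the line reaches \<open>u\<close>; starting at
      \<open>t - y\<close> makes it pass there at time \<open>t\<close>.\<close>
    define y where "y = (u + U) * d / (2 * U)"
    have y: "0 < y" "y < d"
    proof -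
      have u: "0 < u + U" "u + U < 2 * U" using False by auto
      then show "0 < y" using d U_pos by (simp add: y_def)
      have "(u + U) * d < 2 * U * d" using u d by simp
      then show "y < d" using U_pos by (simp add: y_def divide_less_eq mult.commute)
    qed
    have "Eu (line d y) (t - y + y) = 0"
      by (rule line_mean_bounds(3)[OF assms sh line_mean_eq_0[OF assms sh] y])
    moreover have "line d y = u" using d U_pos by (simp add: y_def)
    ultimately show ?thesis by simp
  qed (rule Eu_outside)
  then have "((\<lambda>u. E u t) has_real_derivative 0) (at u)" for u
    using E_deriv_u[of t u] by simp
  then have "E u t = E U t"
    by (intro DERIV_isconst_all) auto
  then show ?thesis using supp_u[of U t] U_pos by simp
qed

end

section \<open>Radial potentials\<close>

text \<open>Write \<open>F x r - F a r\<close> as the integral of \<open>Fu\<close>, differentiate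
  in \<open>r\<close> under the integral sign, and then in \<open>x\<close> by the fundamental
  theorem.\<close>

lemma mixed_partials_eq:
  fixes F Fu Fr Fur Fru :: "real \<Rightarrow> real \<Rightarrow> real"
  assumes Fu: "\<And>u r. ((\<lambda>u. F u r) has_real_derivative Fu u r) (at u)"
    and Fr: "\<And>u r. (F u has_real_derivative Fr u r) (at r)"
    and Fur: "\<And>u r. (Fu u has_real_derivative Fur u r) (at r)"
    and Fru: "\<And>u r. ((\<lambda>u. Fr u r) has_real_derivative Fru u r) (at u)"
    and cont: "continuous_on UNIV (\<lambda>z. Fur (fst z) (snd z))"
  shows "Fru u r = Fur u r"
proof -
  define a where "a = u - 1"
  have Fr_eq: "Fr x r = Fr a r + integral {a..x} (\<lambda>y. Fur y r)" if x: "x \<in> {a..u + 1}" for x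
  proof -
    have int: "((\<lambda>y. Fu y r') has_integral (F x r' - F a r')) {a..x}" for r'
      using x by (intro integral_deriv_real Fu) auto
    have "((\<lambda>r. integral (cbox a x) (\<lambda>y. Fu y r)) has_real_derivative
        integral (cbox a x) (\<lambda>y. Fur y r)) (at r within UNIV)"
    proof (rule leibniz_rule_field_derivative)
      show "(\<lambda>y. Fu y r') integrable_on cbox a x" for r'
        using int[of r'] by (auto simp: integrable_on_def)
      show "continuous_on (UNIV \<times> cbox a x) (\<lambda>(r, y). Fur y r)"
        unfolding case_prod_unfold
        by (intro continuous_on_compose_pair[OF cont] continuous_intros)
    qed (use Fur in auto)
    then have "((\<lambda>r. F x r - F a r) has_real_derivative integral {a..x} (\<lambda>y. Fur y r)) (at r)"
      by (simp add: integral_unique[OF int])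
    moreover have "((\<lambda>r. F x r - F a r) has_real_derivative Fr x r - Fr a r) (at r)"
      by (intro DERIV_diff Fr)
    ultimately show ?thesis using DERIV_unique by force
  qed
  have "continuous_on {a..u + 1} (\<lambda>y. Fur y r)"
    by (intro continuous_on_compose_pair[OF cont] continuous_intros)
  then have "((\<lambda>x. integral {a..x} (\<lambda>y. Fur y r)) has_real_derivative Fur u r) (at u within {a..u + 1})"
    by (rule integral_has_real_derivative) (simp add: a_def)
  then have "((\<lambda>x. Fr a r + integral {a..x} (\<lambda>y. Fur y r)) has_real_derivative Fur u r)
      (at u within {a..u + 1})"
    by (auto intro!: derivative_eq_intros)
  then have "((\<lambda>x. Fr x r) has_real_derivative Fur u r) (at u within {a..u + 1})"
    by (rule has_field_derivative_transform_within[where d = 1, OF _ _ _ Fr_eq[symmetric]])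
      (auto simp: a_def)
  then have "((\<lambda>x. Fr x r) has_real_derivative Fur u r) (at u)"
    using at_within_interior[of u "{a..u + 1}"] by (simp add: a_def)
  with Fru show ?thesis by (rule DERIV_unique)
qed

lemma deriv_along_direction:
  fixes f :: "'a::real_normed_vector \<Rightarrow> real"
  assumes "(f has_derivative D) (at x)"
  shows "deriv (\<lambda>s. f (x + s *\<^sub>R v)) 0 = D v"
proof -
  have "((\<lambda>s::real. x + s *\<^sub>R v) has_derivative (\<lambda>s. s *\<^sub>R v)) (at 0)"
    by (auto intro!: derivative_eq_intros)
  moreover have "(f has_derivative D) (at (x + 0 *\<^sub>R v))" using assms by simp
  ultimately have "((\<lambda>s. f (x + s *\<^sub>R v)) has_derivative (\<lambda>s. D (s *\<^sub>R v))) (at 0)"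
    by (rule has_derivative_compose)
  moreover have "(\<lambda>s. D (s *\<^sub>R v)) = (\<lambda>s. D v * s)"
    using has_derivative_linear[OF assms] by (auto simp: linear_scale)
  ultimately show ?thesis
    by (auto simp: has_field_derivative_def intro!: DERIV_imp_deriv)
qed

text \<open>\<open>smooth\<close> makes every iterated directional derivative totally
  differentiable, so its restriction to the plane is differentiable and the partials are again
  iterated directional derivatives.\<close>

lemma dirderiv_on_plane:
  fixes f :: "real \<times> 'b::real_normed_vector \<Rightarrow> real" and e :: 'b
  assumes "smooth f"
  shows "((\<lambda>z. dirderiv f vs (fst z, snd z *\<^sub>R e)) has_derivative
    (\<lambda>h. dirderiv f ((1, 0) # vs) (u, r *\<^sub>R e) * fst h + dirderiv f ((0, e) # vs) (u, r *\<^sub>R e) * snd h))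
    (at (u, r))"
proof -
  obtain D where D: "(dirderiv f vs has_derivative D) (at (u, r *\<^sub>R e))"
    using assms unfolding smooth_def differentiable_def by blast
  have "((\<lambda>z :: real \<times> real. (fst z, snd z *\<^sub>R e)) has_derivative (\<lambda>h. (fst h, snd h *\<^sub>R e))) (at (u, r))"
    by (auto intro!: derivative_eq_intros)
  then have "((\<lambda>z. dirderiv f vs (fst z, snd z *\<^sub>R e)) has_derivative (\<lambda>h. D (fst h, snd h *\<^sub>R e))) (at (u, r))"
    by (rule has_derivative_compose) (simp add: D)
  moreover have "D (fst h, snd h *\<^sub>R e)
      = dirderiv f ((1, 0) # vs) (u, r *\<^sub>R e) * fst h + dirderiv f ((0, e) # vs) (u, r *\<^sub>R e) * snd h" for h
  proof -
    have lin: "linear D" using has_derivative_linear[OF D] .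
    have "D (fst h, snd h *\<^sub>R e) = D (fst h *\<^sub>R (1, 0) + snd h *\<^sub>R (0, e))" by simp
    also have "\<dots> = fst h * D (1, 0) + snd h * D (0, e)"
      unfolding linear_add[OF lin] linear_scale[OF lin] by simp
    finally show ?thesis
      unfolding dirderiv.simps deriv_along_direction[OF D] by (simp add: mult.commute)
  qed
  ultimately show ?thesis by simp
qed

section \<open>The potential as a function of \<open>u\<close> and a signed radius\<close>

locale radial_potential =
  fixes V :: "real \<Rightarrow> real \<Rightarrow> real" and U R :: real
  assumes smoothV: "smooth (\<lambda>z :: real \<times> (real ^ 2). V (fst z) (norm (snd z)))"
    and U_pos: "U > 0" and R_pos: "R > 0"
    and supp: "\<And>u r. \<bar>u\<bar> \<ge> U \<or> r > R \<Longrightarrow> V u r = 0"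
begin

definition e1 :: "real ^ 2" where "e1 = axis 1 1"
definition du :: "real \<times> (real ^ 2)" where "du = (1, 0)"
definition dr :: "real \<times> (real ^ 2)" where "dr = (0, e1)"

text \<open>Restricting to a line through the origin extends \<open>V u\<close> smoothly to negative radii.\<close>

definition G :: "(real \<times> (real ^ 2)) list \<Rightarrow> real \<Rightarrow> real \<Rightarrow> real" where
  "G vs u r = dirderiv (\<lambda>z :: real \<times> (real ^ 2). V (fst z) (norm (snd z))) vs (u, r *\<^sub>R e1)"

lemma G_Nil: "G [] u r = V u \<bar>r\<bar>"
  by (simp add: G_def e1_def)

lemma G_derivative:
  "((\<lambda>z. G vs (fst z) (snd z)) has_derivative (\<lambda>h. G (du # vs) u r * fst h + G (dr # vs) u r * snd h))
    (at (u, r))"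
  unfolding G_def du_def dr_def by (rule dirderiv_on_plane[OF smoothV])

lemma G_deriv_u: "((\<lambda>u. G vs u r) has_real_derivative G (du # vs) u r) (at u)"
  using has_real_derivative_compose_pair[of "G vs", OF G_derivative, of "\<lambda>u. u" 1 u "\<lambda>_. r" 0]
  by (auto intro: derivative_eq_intros)

lemma G_deriv_r: "(G vs u has_real_derivative G (dr # vs) u r) (at r)"
  using has_real_derivative_compose_pair[of "G vs", OF G_derivative, of "\<lambda>_. u" 0 r "\<lambda>r. r" 1]
  by (auto intro: derivative_eq_intros)

lemma cont_G: "continuous_on S (\<lambda>z. G vs (fst z) (snd z))"
  using G_derivative by (auto intro!: continuous_at_imp_continuous_on has_derivative_continuous)

lemma G_outside: "set vs \<subseteq> {du, dr} \<Longrightarrow> U \<le> \<bar>u\<bar> \<or> R < \<bar>r\<bar> \<Longrightarrow> G vs u r = 0"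
proof (induction vs arbitrary: u r)
  case Nil
  then show ?case using supp by (simp add: G_Nil)
next
  case (Cons a vs)
  have IH: "G vs u r = 0" if "U \<le> \<bar>u\<bar> \<or> R < \<bar>r\<bar>" for u r
    using Cons that by simp
  have const: "D = 0" if "(f has_real_derivative D) (at x)" "f = (\<lambda>_. 0)" for f :: "real \<Rightarrow> real" and D x
    using that DERIV_unique[of "\<lambda>_. 0" D x 0] by auto
  have "G (du # vs) u r = 0 \<and> G (dr # vs) u r = 0"
  proof (cases "U \<le> \<bar>u\<bar>")
    case True
    then show ?thesis
      using const[OF G_deriv_r, of vs u r] deriv_zero_outside_interval[OF G_deriv_u _ True U_pos, of vs r] IH
      by auto
  next
    case False
    then have r: "R < \<bar>r\<bar>" using Cons by simp
    then show ?thesis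
      \<comment> \<open>The radius \<open>|r|\<close> itself serves as the edge: beyond it
        everything vanishes by induction.\<close>
      using const[OF G_deriv_u, of vs r u] deriv_zero_outside_interval[OF G_deriv_r, of "\<bar>r\<bar>" vs u r] IH R_pos
      by auto
  qed
  then show ?case using Cons.prems by auto
qed

lemma G_symmetric: "G [du, dr] u r = G [dr, du] u r"
  by (rule mixed_partials_eq[of "G []" "G [du]" "G [dr]" "G [dr, du]" "G [du, dr]"])
    (intro G_deriv_u G_deriv_r cont_G)+

lemma G_bounded:
  assumes "set vs \<subseteq> {du, dr}"
  obtains B where "0 \<le> B" "\<And>u r. \<bar>G vs u r\<bar> \<le> B"
proof -
  have "compact ((\<lambda>z. G vs (fst z) (snd z)) ` ({- U..U} \<times> {- R..R}))"
    by (intro compact_continuous_image cont_G compact_Times) auto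
  then have "bounded ((\<lambda>z. G vs (fst z) (snd z)) ` ({- U..U} \<times> {- R..R}))"
    by (rule compact_imp_bounded)
  then obtain B where B: "\<And>z. z \<in> {- U..U} \<times> {- R..R} \<Longrightarrow> \<bar>G vs (fst z) (snd z)\<bar> \<le> B"
    unfolding bounded_iff by fastforce
  have "\<bar>G vs u r\<bar> \<le> max 0 B" for u r
  proof (cases "\<bar>u\<bar> \<le> U \<and> \<bar>r\<bar> \<le> R")
    case True
    then show ?thesis using B[of "(u, r)"] by (auto simp: abs_le_iff)
  next
    case False
    then show ?thesis using G_outside[OF assms, of u r] by auto
  qed
  then show thesis using that[of "max 0 B"] by auto
qed

text \<open>\<open>G\<close> is bounded and vanishes for \<open>t > ln R\<close>, while the
  exponential weight is increasing or constant in \<open>t\<close>.\<close>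

lemma exp_G_bounded:
  assumes "set vs \<subseteq> {du, dr}" "0 \<le> k"
  obtains B where "0 \<le> B" "\<And>u t. \<bar>exp (k * t) * G vs u (exp t)\<bar> \<le> B"
proof -
  obtain B where B: "0 \<le> B" "\<And>u r. \<bar>G vs u r\<bar> \<le> B" using G_bounded[OF assms(1)] by blast
  have "\<bar>exp (k * t) * G vs u (exp t)\<bar> \<le> exp (k * ln R) * B" for u t
  proof (cases "t \<le> ln R")
    case True
    then have "exp (k * t) \<le> exp (k * ln R)" using assms by (simp add: mult_left_mono)
    then show ?thesis unfolding abs_mult using B by (intro mult_mono) auto
  next
    case False
    then have "R < exp t" using R_pos by (metis exp_less_cancel_iff exp_ln not_le)
    then show ?thesis using G_outside[OF assms(1), of u "exp t"] B by simp
  qed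
  moreover have "0 \<le> exp (k * ln R) * B" using B by simp
  ultimately show thesis using that by blast
qed

lemma exp_G_derivative:
  "((\<lambda>z. exp (k * snd z) * G vs (fst z) (exp (snd z))) has_derivative
    (\<lambda>h. exp (k * t) * G (du # vs) u (exp t) * fst h +
      (k * (exp (k * t) * G vs u (exp t)) + exp ((k + 1) * t) * G (dr # vs) u (exp t)) * snd h)) (at (u, t))"
proof -
  have "((\<lambda>z :: real \<times> real. (fst z, exp (snd z))) has_derivative (\<lambda>h. (fst h, exp t * snd h))) (at (u, t))"
    by (auto intro!: derivative_eq_intros)
  moreover have "((\<lambda>z. G vs (fst z) (snd z)) has_derivative
      (\<lambda>h. G (du # vs) u (exp t) * fst h + G (dr # vs) u (exp t) * snd h)) (at (fst (u, t), exp (snd (u, t))))"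
    using G_derivative[of vs u "exp t"] by simp
  ultimately have "((\<lambda>z. G vs (fst (fst z, exp (snd z))) (snd (fst z, exp (snd z)))) has_derivative
      (\<lambda>h. G (du # vs) u (exp t) * fst (fst h, exp t * snd h)
        + G (dr # vs) u (exp t) * snd (fst h, exp t * snd h))) (at (u, t))"
    by (rule has_derivative_compose)
  then have G: "((\<lambda>z. G vs (fst z) (exp (snd z))) has_derivative
      (\<lambda>h. G (du # vs) u (exp t) * fst h + G (dr # vs) u (exp t) * (exp t * snd h))) (at (u, t))"
    by simp
  have "((\<lambda>z :: real \<times> real. exp (k * snd z)) has_derivative (\<lambda>h. exp (k * t) * (k * snd h))) (at (u, t))"
    by (auto intro!: derivative_eq_intros)
  from has_derivative_mult[OF this G] show ?thesis
    by (rule has_derivative_eq_rhs) (auto simp: algebra_simps exp_add)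
qed

text \<open>This is the \<open>W\<close> of the theorem multiplied by e^(2t), that is, the
  \<open>E\<close> of the strip. In its time derivatives each differentiation in the radius
  contributes another factor e^t, whence the exponents 3 and 4.\<close>

definition W :: "real \<Rightarrow> real \<Rightarrow> real" where "W u t = exp (2 * t) * G [] u (exp t)"
definition Wu :: "real \<Rightarrow> real \<Rightarrow> real" where "Wu u t = exp (2 * t) * G [du] u (exp t)"
definition Wt :: "real \<Rightarrow> real \<Rightarrow> real" where
  "Wt u t = 2 * (exp (2 * t) * G [] u (exp t)) + exp (3 * t) * G [dr] u (exp t)"
definition Wuu :: "real \<Rightarrow> real \<Rightarrow> real" where "Wuu u t = exp (2 * t) * G [du, du] u (exp t)"
definition Wut :: "real \<Rightarrow> real \<Rightarrow> real" where
  "Wut u t = 2 * (exp (2 * t) * G [du] u (exp t)) + exp (3 * t) * G [dr, du] u (exp t)"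
definition Wtt :: "real \<Rightarrow> real \<Rightarrow> real" where
  "Wtt u t = 2 * (2 * (exp (2 * t) * G [] u (exp t)) + exp (3 * t) * G [dr] u (exp t))
    + (3 * (exp (3 * t) * G [dr] u (exp t)) + exp (4 * t) * G [dr, dr] u (exp t))"

lemma W_derivative:
  "((\<lambda>z. W (fst z) (snd z)) has_derivative (\<lambda>h. Wu u t * fst h + Wt u t * snd h)) (at (u, t))"
  unfolding W_def Wu_def Wt_def using exp_G_derivative[of 2 "[]" t u] by simp

lemma Wu_derivative:
  "((\<lambda>z. Wu (fst z) (snd z)) has_derivative (\<lambda>h. Wuu u t * fst h + Wut u t * snd h)) (at (u, t))"
  unfolding Wu_def Wuu_def Wut_def using exp_G_derivative[of 2 "[du]" t u] by simp

lemma Wt_derivative: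
  "((\<lambda>z. Wt (fst z) (snd z)) has_derivative (\<lambda>h. Wut u t * fst h + Wtt u t * snd h)) (at (u, t))"
  unfolding Wt_def
  using has_derivative_add[OF has_derivative_mult_right[OF exp_G_derivative[of 2 "[]" t u], of 2]
      exp_G_derivative[of 3 "[dr]" t u]]
  by (rule has_derivative_eq_rhs) (auto simp: Wut_def Wtt_def G_symmetric algebra_simps)

lemma cont_exp_G: "continuous_on UNIV (\<lambda>z. exp (k * snd z) * G vs (fst z) (exp (snd z)))"
  using exp_G_derivative by (auto intro!: continuous_at_imp_continuous_on has_derivative_continuous)

lemma W_eq: "W u t = exp (2 * t) * V u (exp t)"
  by (simp add: W_def G_Nil)

lemma strip_potential_W:
  obtains C where "strip_potential W Wu Wt Wuu Wut Wtt U (ln R) C"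
proof -
  obtain B1 where B1: "0 \<le> B1" "\<And>u t. \<bar>exp (2 * t) * G [] u (exp t)\<bar> \<le> B1"
    by (rule exp_G_bounded[of "[]" 2]) auto
  \<comment> \<open>One of the two exponential factors is bounded together with \<open>G\<close>;
    the other one is the decay e^t.\<close>
  obtain B2 where B2: "0 \<le> B2" "\<And>u t. \<bar>exp (1 * t) * G [] u (exp t)\<bar> \<le> B2"
    by (rule exp_G_bounded[of "[]" 1]) auto
  obtain B3 where B3: "0 \<le> B3" "\<And>u t. \<bar>exp (2 * t) * G [du] u (exp t)\<bar> \<le> B3"
    by (rule exp_G_bounded[of "[du]" 2]) auto
  obtain B4 where B4: "0 \<le> B4" "\<And>u t. \<bar>exp (3 * t) * G [dr] u (exp t)\<bar> \<le> B4"
    by (rule exp_G_bounded[of "[dr]" 3]) auto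
  obtain B5 where B5: "0 \<le> B5" "\<And>u t. \<bar>exp (2 * t) * G [du, du] u (exp t)\<bar> \<le> B5"
    by (rule exp_G_bounded[of "[du, du]" 2]) auto
  obtain B6 where B6: "0 \<le> B6" "\<And>u t. \<bar>exp (3 * t) * G [dr, du] u (exp t)\<bar> \<le> B6"
    by (rule exp_G_bounded[of "[dr, du]" 3]) auto
  define C where "C = 1 + 2 * B1 + B2 + 2 * B3 + B4 + B5 + B6"
  have C: "0 < C" using B1 B2 B3 B4 B5 B6 by (simp add: C_def)
  have "strip_potential W Wu Wt Wuu Wut Wtt U (ln R) C"
  proof
    show "0 < U" "0 < C" by (fact U_pos, fact C)
    show "continuous_on UNIV (\<lambda>z. Wuu (fst z) (snd z))"
      unfolding Wuu_def by (rule cont_exp_G)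
    show "continuous_on UNIV (\<lambda>z. Wut (fst z) (snd z))"
      unfolding Wut_def by (intro continuous_intros cont_exp_G)
    show "continuous_on UNIV (\<lambda>z. Wtt (fst z) (snd z))"
      unfolding Wtt_def by (intro continuous_intros cont_exp_G)
    show "W u t = 0" if "U \<le> \<bar>u\<bar>" for u t
      using that supp by (simp add: W_eq)
    show "W u t = 0" if "ln R < t" for u t
    proof -
      have "R < exp t" using that R_pos by (metis exp_less_cancel_iff exp_ln)
      then show ?thesis using supp by (simp add: W_eq)
    qed
    fix u t
    show "\<bar>W u t\<bar> \<le> C"
      using B1(2)[of t u] B1 B2 B3 B4 B5 B6 unfolding W_def C_def by linarith
    have "\<bar>W u t\<bar> = exp t * \<bar>exp (1 * t) * G [] u (exp t)\<bar>"
      by (simp add: W_def abs_mult mult_exp_exp flip: mult.assoc)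
    also have "\<dots> \<le> exp t * C"
      using B2(2)[of t u] B1 B2 B3 B4 B5 B6 unfolding C_def
      by (intro mult_left_mono[OF _ exp_ge_zero]) linarith
    finally show "\<bar>W u t\<bar> \<le> C * exp t" by (simp add: mult.commute)
    show "\<bar>Wu u t\<bar> \<le> C"
      using B3(2)[of t u] B1 B2 B3 B4 B5 B6 unfolding Wu_def C_def by linarith
    show "\<bar>Wt u t\<bar> \<le> C"
      using B1(2)[of t u] B4(2)[of t u] B1 B2 B3 B4 B5 B6 unfolding Wt_def C_def by linarith
    show "\<bar>Wuu u t\<bar> \<le> C"
      using B5(2)[of t u] B1 B2 B3 B4 B5 B6 unfolding Wuu_def C_def by linarith
    show "\<bar>Wut u t\<bar> \<le> C"
      using B3(2)[of t u] B6(2)[of t u] B1 B2 B3 B4 B5 B6 unfolding Wut_def C_def by linarith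
  qed (fact W_derivative Wu_derivative Wt_derivative)+
  then show thesis by (rule that)
qed

lemma deriv_V: "deriv (\<lambda>v. V v (exp t)) u = G [du] u (exp t)"
  using G_deriv_u[of "[]" "exp t" u] by (auto simp: G_Nil intro: DERIV_imp_deriv)

lemma deriv2_V: "deriv (\<lambda>v. deriv (\<lambda>w. V w (exp t)) v) u = G [du, du] u (exp t)"
  unfolding deriv_V using G_deriv_u[of "[du]" "exp t" u] by (rule DERIV_imp_deriv)

end

section \<open>Return to the original system\<close>

theorem theorem4:
  fixes V :: "real \<Rightarrow> real \<Rightarrow> real" and U R :: real
  assumes smoothV: "smooth (\<lambda>z :: real \<times> (real ^ 2). V (fst z) (norm (snd z)))"
    and U_pos: "U > 0" and R_pos: "R > 0"
    and supp: "\<And>u r. \<bar>u\<bar> \<ge> U \<or> r > R \<Longrightarrow> V u r = 0"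
    and nonzero: "\<exists>u t. V u (exp t) \<noteq> 0"
  shows "\<exists>u p. is_solution (\<lambda>u t. V u (exp t)) u p \<and>
               has_conjugate_points (\<lambda>u t. V u (exp t)) u"
proof (rule ccontr)
  assume none: "\<not> ?thesis"
  interpret radial_potential V U R
    using assms(1-4) by unfold_locales
  obtain C where "strip_potential W Wu Wt Wuu Wut Wtt U (ln R) C"
    by (rule strip_potential_W)
  then interpret P: strip_potential W Wu Wt Wuu Wut Wtt U "ln R" C .
  have P.no_conjugate
    unfolding P.no_conjugate_def
  proof (intro allI impI)
    fix d s v w \<xi> \<eta> t1 t2 t
    assume cr: "P.crossing d s v w" and j: "P.jacobi s v \<xi> \<eta>"
      and t: "t1 < t2" "\<xi> t1 = 0" "\<xi> t2 = 0"
    \<comment> \<open>Crossings and Jacobi fields run in elapsed time; substituting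
      \<open>t - s\<close> turns them into solutions in absolute time.\<close>
    have shift: "((\<lambda>t. f (t - s)) has_real_derivative D) (at t)"
      if "(f has_real_derivative D) (at (t - s))" for f :: "real \<Rightarrow> real" and D t
    proof -
      have "((\<lambda>t. t - s) has_real_derivative 1) (at t)"
        by (auto intro!: derivative_eq_intros)
      from DERIV_chain2[of f D "\<lambda>t. t - s", OF that this] show ?thesis by simp
    qed
    define u where "u t = v (t - s)" for t
    have "is_solution (\<lambda>u t. V u (exp t)) u (\<lambda>t. w (t - s))"
      unfolding is_solution_def u_def deriv_V Wu_def[symmetric]
    proof (intro allI conjI shift)
      fix t
      show "(v has_real_derivative w (t - s)) (at (t - s))"
        using cr by (simp add: P.crossing_def)
      have "(w has_real_derivative - Wu (v (t - s)) (s + (t - s))) (at (t - s))"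
        using cr unfolding P.crossing_def by blast
      then show "(w has_real_derivative - Wu (v (t - s)) t) (at (t - s))" by simp
    qed
    then have no: "\<not> has_conjugate_points (\<lambda>u t. V u (exp t)) u" using none by blast
    show "\<xi> t = 0"
    proof (rule ccontr)
      assume ne: "\<xi> t \<noteq> 0"
      have "has_conjugate_points (\<lambda>u t. V u (exp t)) u"
        unfolding has_conjugate_points_def deriv2_V Wuu_def[symmetric]
      \<comment> \<open>The zeros \<open>t1\<close> and \<open>t2\<close> in elapsed time occur at
        the absolute times \<open>s + t1\<close> and \<open>s + t2\<close>.\<close>
      proof (rule exI[of _ "s + t1"], rule exI[of _ "s + t2"], rule exI[of _ "\<lambda>t. \<xi> (t - s)"],
          rule exI[of _ "\<lambda>t. \<eta> (t - s)"], intro conjI allI shift)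
        fix t
        show "(\<xi> has_real_derivative \<eta> (t - s)) (at (t - s))"
          using j by (simp add: P.jacobi_def)
        have "(\<eta> has_real_derivative - (Wuu (v (t - s)) (s + (t - s)) * \<xi> (t - s))) (at (t - s))"
          using j unfolding P.jacobi_def by blast
        then show "(\<eta> has_real_derivative - (Wuu (u t) t * \<xi> (t - s))) (at (t - s))"
          by (simp add: u_def)
      next
        show "\<exists>t. \<xi> (t - s) \<noteq> 0" using ne by (intro exI[of _ "s + t"]) simp
      qed (use t in auto)
      with no show False ..
    qed
  qed
  then have "W u t = 0" for u t by (rule P.potential_eq_0)
  then show False using nonzero by (simp add: W_eq)
qed

end
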